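(* Fix any one of the following six families of grids $\pi^N=\{\tau_0,\dots,\tau_N\}\subset[-1,1]$, $N\ge 1$: Chebyshev-Gauss-Lobatto, Chebyshev-Gauss-Radau, Chebyshev-Gauss, Legendre-Gauss-Lobatto, Legendre-Gauss-Radau, Legendre-Gauss. Then the $a$- and $b$-forms of the Birkhoff interpolant over $\pi^N$ are equivalent, in the sense that their difference is vanishingly small as $N\to\infty$: for every bounded differentiable function $y:[-1,1]\to\mathbb{R}$ and every $\epsilon>0$ there exists $N_\epsilon\in\mathbb{N}$ such that for all $N\ge N_\epsilon$ and all $\tau\in[-1,1]$, $$\left| I^N_b y(\tau)-I^N_a y(\tau)\right|\le \epsilon .$$
   Context: Grids. For $N\ge1$ the Chebyshev grids are $\tau_j=-\cos(\xi_j\pi)$, $j=0,\dots,N$, where - Chebyshev-Gauss-Lobatto (CGL): $\xi_j=\frac{j}{N}$; - Chebyshev-Gauss-Radau (CGR): $\xi_j=\frac{2j}{2N+1}$; - Chebyshev-Gauss (CG): $\xi_j=\frac{2j+1}{2N+2}$. The Legendre grids are the $N+1$ zeros (in increasing order) of the polynomial $z$, where, with $P_N$ the Legendre polynomial of degree $N$, - Legendre-Gauss-Lobatto (LGL): $z(\tau)=(1-\tau^2)\dot P_N(\tau)$; - Legendre-Gauss-Radau (LGR): $z(\tau)=P_N(\tau)+P_{N+1}(\tau)$; - Legendre-Gauss (LG): $z(\tau)=P_{N+1}(\tau)$. Birkhoff interpolants. Given a grid $\pi^N=\{\tau_0,\dots,\tau_N\}$, the Birkhoff basis functions $B_j^a,B_j^b$,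 $j=0,\dots,N$, are the polynomials of degree at most $N+1$ determined by $$B_j^a(-1)=0,\quad \dot B_j^a(\tau_i)=\delta_{ij},\qquad B_j^b(1)=0,\quad \dot B_j^b(\tau_i)=\delta_{ij},\qquad i,j=0,\dots,N.$$ Equivalently, $B_j^a(\tau)=\int_{-1}^{\tau}\ell_j(s)\,ds$ and $B_j^b(\tau)=-\int_{\tau}^{1}\ell_j(s)\,ds$, where $\ell_j$ is the Lagrange basis polynomial of degree $N$ with $\ell_j(\tau_i)=\delta_{ij}$. For a differentiable function $y:[-1,1]\to\mathbb{R}$, with derivative $\dot y$, the $a$- and $b$-forms of the Birkhoff interpolant are $$I_a^N y(\tau)=y(-1)+\sum_{j=0}^N \dot y(\tau_j)B_j^a(\tau),\qquad I_b^N y(\tau)=y(1)+\sum_{j=0}^N \dot y(\tau_j)B_j^b(\tau).$$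
   Formalization: The formal theorem additionally assumes that the derivative of y is Riemann integrable on [-1,1]; for merely bounded differentiable y the claim is false, since a nonnegative bounded derivative can vanish at every grid point of every N while y(1) > y(-1). *)

theory Defs
  imports "HOL-Analysis.Analysis" "HOL-Computational_Algebra.Polynomial"
begin

text \<open>Legendre polynomials, normalised by \<open>P\<^sub>n(1) = 1\<close> (Rodrigues' formula).\<close>

definition legendre :: "nat \<Rightarrow> real poly" where
  "legendre n = smult (1 / (2 ^ n * fact n)) ((pderiv ^^ n) ([:-1, 0, 1:] ^ n))"

datatype grid_family = CGL | CGR | CG | LGL | LGR | LG

definition zeros :: "real poly \<Rightarrow> nat \<Rightarrow> real" where
  "zeros z j = sorted_list_of_set {x. poly z x = 0} ! j"

text \<open>\<open>node F N j\<close> is the grid point \<open>\<tau>\<^sub>j\<close>; it is meaningful for \<open>N \<ge> 1\<close> and \<open>j \<le> N\<close>.\<close>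

fun node :: "grid_family \<Rightarrow> nat \<Rightarrow> nat \<Rightarrow> real" where
  "node CGL N j = - cos (real j / real N * pi)"
| "node CGR N j = - cos ((2 * real j) / (2 * real N + 1) * pi)"
| "node CG N j = - cos ((2 * real j + 1) / (2 * real N + 2) * pi)"
| "node LGL N j = zeros ([:1, 0, -1:] * pderiv (legendre N)) j"
| "node LGR N j = zeros (legendre N + legendre (N + 1)) j"
| "node LG N j = zeros (legendre (N + 1)) j"

definition birkhoff_basis_a :: "(nat \<Rightarrow> real) \<Rightarrow> nat \<Rightarrow> nat \<Rightarrow> real poly" where
  "birkhoff_basis_a t N j = (THE B. degree B \<le> N + 1 \<and> poly B (-1) = 0 \<and>
     (\<forall>i\<le>N. poly (pderiv B) (t i) = (if i = j then 1 else 0)))"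

definition birkhoff_basis_b :: "(nat \<Rightarrow> real) \<Rightarrow> nat \<Rightarrow> nat \<Rightarrow> real poly" where
  "birkhoff_basis_b t N j = (THE B. degree B \<le> N + 1 \<and> poly B 1 = 0 \<and>
     (\<forall>i\<le>N. poly (pderiv B) (t i) = (if i = j then 1 else 0)))"

text \<open>Here \<open>y'\<close> stands for the derivative of \<open>y\<close> on \<open>[-1, 1]\<close>.\<close>

definition birkhoff_interp_a ::
    "(nat \<Rightarrow> real) \<Rightarrow> nat \<Rightarrow> (real \<Rightarrow> real) \<Rightarrow> (real \<Rightarrow> real) \<Rightarrow> real \<Rightarrow> real" where
  "birkhoff_interp_a t N y y' x = y (-1) + (\<Sum>j\<le>N. y' (t j) * poly (birkhoff_basis_a t N j) x)"

definition birkhoff_interp_b ::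
    "(nat \<Rightarrow> real) \<Rightarrow> nat \<Rightarrow> (real \<Rightarrow> real) \<Rightarrow> (real \<Rightarrow> real) \<Rightarrow> real \<Rightarrow> real" where
  "birkhoff_interp_b t N y y' x = y 1 + (\<Sum>j\<le>N. y' (t j) * poly (birkhoff_basis_b t N j) x)"

text \<open>
  Riemann integrability is the library's gauge integrability with the gauge restricted to balls
  of constant radius. The library's \<open>integrable_on\<close> (Henstock-Kurzweil) would be too weak here:
  it holds for every derivative.
\<close>

definition riemann_integrable :: "(real \<Rightarrow> real) \<Rightarrow> real \<Rightarrow> real \<Rightarrow> bool" where
  "riemann_integrable f a b \<longleftrightarrow> (\<exists>I. \<forall>e>0. \<exists>d>0. \<forall>p.
     p tagged_division_of {a..b} \<and> (\<lambda>x. ball x d) fine p \<longrightarrow>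
       \<bar>(\<Sum>(x, k)\<in>p. measure lborel k * f x) - I\<bar> < e)"

end

theory Submission
  imports Defs
begin

text \<open>
  The two basis functions attached to a grid point have the same derivative, so they differ by a
  constant: \<open>B\<^sub>j\<^sup>b - B\<^sub>j\<^sup>a = - w\<^sub>j\<close>, where \<open>w\<^sub>j = B\<^sub>j\<^sup>a(1)\<close> is the integral of the \<open>j\<close>-th Lagrange polynomial
  over \<open>[-1, 1]\<close>. The difference of the two interpolants is therefore independent of \<open>\<tau>\<close>: it equals
  \<open>y(1) - y(-1) - (\<Sum>j\<le>N. w\<^sub>j y'(\<tau>\<^sub>j))\<close>, and by the fundamental theorem of calculus it is the error of
  the interpolatory quadrature rule with nodes \<open>\<tau>\<^sub>j\<close> applied to \<open>y'\<close>. The claim says that these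
  quadrature rules converge for the Riemann integrable function \<open>y'\<close>.

  Convergence needs only two properties: exactness for polynomials of degree at most \<open>N\<close>, which
  every interpolatory rule has, and nonnegativity of the weights. By Weierstrass approximation, the
  mass of the weights in an interval is asymptotically at most its length; over the pieces of a fixed
  partition this makes the quadrature sum comparable with a Riemann sum whose tags are nodes at which
  the function is largest in their piece (\<open>eventually_sum_le\<close>).

  The six families enter through the nonnegativity of their weights. It follows for the weight \<open>w\<^sub>j\<close> from
  a polynomial \<open>q\<close> of degree at most \<open>N\<close> that vanishes at the other nodes, is positive at \<open>\<tau>\<^sub>j\<close> and has
  nonnegative integral, since the integral is \<open>w\<^sub>j q(\<tau>\<^sub>j)\<close>.

  For the Legendre grids, \<open>q\<close> is the remainder of \<open>\<omega>\<^sub>j\<^sup>2\<close> modulo the node polynomial \<open>z\<close>, where \<open>\<omega>\<^sub>j\<close>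
  vanishes at the other nodes. Its integral is controlled by the orthogonality of \<open>z\<close>
  to polynomials of low degree (\<open>birkhoff_weight_nonneg_if_orthogonal\<close>). Orthogonality and the
  location of the zeros both come from Rodrigues' formula, by integration by parts and by Rolle's
  theorem; the Radau case uses a Rodrigues formula for \<open>P\<^sub>N + P\<^sub>N\<^sub>+\<^sub>1\<close>.

  For the Chebyshev grids, \<open>q\<close> is a cosine sum of Dirichlet kernel type. Its integral is at least
  \<open>2 - 2 (\<Sum>k=1..N. \<bar>\<integral>T\<^sub>k\<bar>)\<close>, and the sum telescopes to at most \<open>1\<close>
  (\<open>admissible_if_discrete_orthogonal\<close>).
\<close>

section \<open>Birkhoff basis functions and interpolatory quadrature\<close>

definition poly_integral :: "real poly \<Rightarrow> real" where
  "poly_integral p = integral {-1..1} (poly p)"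

lemma poly_integrable [simp]: "poly p integrable_on {-1..1::real}" for p :: "real poly"
  by (intro integrable_continuous_interval continuous_intros)

lemma poly_integral_pderiv: "poly_integral (pderiv P) = poly P 1 - poly P (-1)"
proof -
  have "(poly (pderiv P) has_integral poly P 1 - poly P (-1)) {-1..1}"
    by (rule fundamental_theorem_of_calculus)
       (auto simp flip: has_real_derivative_iff_has_vector_derivative
             intro: has_field_derivative_at_within poly_DERIV)
  then show ?thesis
    unfolding poly_integral_def by (rule integral_unique)
qed

lemma poly_integral_0 [simp]: "poly_integral 0 = 0"
  using poly_integral_pderiv[of 0] by simp

lemma poly_integral_add: "poly_integral (p + q) = poly_integral p + poly_integral q"
proof -
  have "poly (p + q) = (\<lambda>x. poly p x + poly q x)" by auto
  then show ?thesis by (simp add: poly_integral_def integral_add)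
qed

lemma poly_integral_smult: "poly_integral (smult c p) = c * poly_integral p"
proof -
  have "poly (smult c p) = (\<lambda>x. c * poly p x)" by auto
  then show ?thesis by (simp add: poly_integral_def)
qed

lemma poly_integral_minus: "poly_integral (- p) = - poly_integral p"
  using poly_integral_smult[of "-1" p] by simp

lemma poly_integral_diff: "poly_integral (p - q) = poly_integral p - poly_integral q"
  using poly_integral_add[of p "- q"] by (simp add: poly_integral_minus)

lemma poly_integral_sum: "poly_integral (\<Sum>i\<in>I. p i) = (\<Sum>i\<in>I. poly_integral (p i))"
  by (induction I rule: infinite_finite_induct) (simp_all add: poly_integral_add)

lemma poly_integral_nonneg: "(\<And>x. x \<in> {-1..1} \<Longrightarrow> 0 \<le> poly p x) \<Longrightarrow> 0 \<le> poly_integral p"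
  unfolding poly_integral_def by (rule integral_nonneg) auto

lemma ex_antiderivative:
  fixes p :: "real poly"
  shows "\<exists>P. pderiv P = p \<and> poly P c = 0 \<and> degree P \<le> degree p + 1"
proof -
  \<comment> \<open>integration of the coefficients; the constant is adjusted afterwards\<close>
  define Q where "Q = (\<Sum>i\<le>degree p. monom (coeff p i / real (Suc i)) (Suc i))"
  have "pderiv Q = p"
    using higher_pderiv_sum[of 1 "\<lambda>i. monom (coeff p i / real (Suc i)) (Suc i)" "{..degree p}"]
    by (simp add: Q_def pderiv_monom poly_as_sum_of_monoms del: of_nat_Suc)
  then have "pderiv (Q - [:poly Q c:]) = p"
    by (simp add: pderiv_diff)
  then show ?thesis
    by (intro exI[of _ "Q - [:poly Q c:]"]) (use degree_pderiv[of "Q - [:poly Q c:]"] in auto)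
qed

lemma ex_lagrange_basis:
  fixes t :: "nat \<Rightarrow> real"
  assumes "inj_on t {..N}" "j \<le> N"
  shows "\<exists>L. degree L \<le> N \<and> (\<forall>i\<le>N. poly L (t i) = (if i = j then 1 else 0))"
proof -
  define W where "W = (\<Prod>i\<in>{..N} - {j}. [:- t i, 1:])"
  have "degree W \<le> (\<Sum>i\<in>{..N} - {j}. 1)"
    unfolding W_def by (rule order.trans[OF degree_prod_sum_le]) auto
  then have "degree W \<le> N"
    using assms(2) by simp
  moreover have "poly W (t i) = 0" if "i \<le> N" "i \<noteq> j" for i
    using that by (auto simp: W_def poly_prod)
  moreover have "poly W (t j) \<noteq> 0"
    using assms by (auto simp: W_def poly_prod inj_on_def)
  ultimately show ?thesis
    by (intro exI[of _ "smult (1 / poly W (t j)) W"]) (auto intro: order.trans[OF degree_smult_le])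
qed

lemma poly_eq_if_eq_on_nodes:
  fixes p q :: "real poly"
  assumes "inj_on t {..N}" "degree p \<le> N" "degree q \<le> N"
    and "\<And>i. i \<le> N \<Longrightarrow> poly p (t i) = poly q (t i)"
  shows "p = q"
  by (rule poly_eqI_degree[of "t ` {..N}"]) (use assms in \<open>auto simp: card_image\<close>)

lemma ex1_birkhoff_basis:
  fixes t :: "nat \<Rightarrow> real"
  assumes "inj_on t {..N}" "j \<le> N"
  shows "\<exists>!B. degree B \<le> N + 1 \<and> poly B c = 0 \<and>
    (\<forall>i\<le>N. poly (pderiv B) (t i) = (if i = j then 1 else 0))"
proof -
  obtain L where L: "degree L \<le> N" "\<forall>i\<le>N. poly L (t i) = (if i = j then 1 else 0)"
    using ex_lagrange_basis[OF assms] by blast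
  obtain P where P: "pderiv P = L" "poly P c = 0" "degree P \<le> degree L + 1"
    using ex_antiderivative by blast
  show ?thesis
  proof (rule ex1I[of _ P])
    fix B assume B: "degree B \<le> N + 1 \<and> poly B c = 0 \<and>
      (\<forall>i\<le>N. poly (pderiv B) (t i) = (if i = j then 1 else 0))"
    have "pderiv B = L"
      by (rule poly_eq_if_eq_on_nodes[OF assms(1)]) (use B L in \<open>auto simp: degree_pderiv\<close>)
    then have "pderiv (B - P) = 0"
      using P by (simp add: pderiv_diff)
    then obtain h where h: "B - P = [:h:]"
      using pderiv_iszero by blast
    moreover have "h = 0"
    proof -
      have "poly (B - P) c = 0" using B P(2) by simp
      then show ?thesis unfolding h by simp
    qed
    ultimately show "B = P" by simp
  qed (use L P in auto)
qed

definition birkhoff_weight :: "(nat \<Rightarrow> real) \<Rightarrow> nat \<Rightarrow> nat \<Rightarrow> real" where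
  "birkhoff_weight t N j = poly (birkhoff_basis_a t N j) 1"

lemma birkhoff_basis_a_props:
  assumes "inj_on t {..N}" "j \<le> N"
  shows "degree (birkhoff_basis_a t N j) \<le> N + 1" "poly (birkhoff_basis_a t N j) (-1) = 0"
    "\<And>i. i \<le> N \<Longrightarrow> poly (pderiv (birkhoff_basis_a t N j)) (t i) = (if i = j then 1 else 0)"
  using theI'[OF ex1_birkhoff_basis[OF assms, of "-1"]] unfolding birkhoff_basis_a_def by blast+

lemma birkhoff_basis_b_props:
  assumes "inj_on t {..N}" "j \<le> N"
  shows "degree (birkhoff_basis_b t N j) \<le> N + 1" "poly (birkhoff_basis_b t N j) 1 = 0"
    "\<And>i. i \<le> N \<Longrightarrow> poly (pderiv (birkhoff_basis_b t N j)) (t i) = (if i = j then 1 else 0)"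
  using theI'[OF ex1_birkhoff_basis[OF assms, of "1"]] unfolding birkhoff_basis_b_def by blast+

text \<open>
  Both basis functions have the \<open>j\<close>-th Lagrange polynomial as derivative, so they differ by a
  constant, which the values at \<open>1\<close> determine.
\<close>

lemma birkhoff_basis_diff:
  assumes "inj_on t {..N}" "j \<le> N"
  shows "poly (birkhoff_basis_b t N j) x - poly (birkhoff_basis_a t N j) x = - birkhoff_weight t N j"
proof -
  note a = birkhoff_basis_a_props[OF assms] and b = birkhoff_basis_b_props[OF assms]
  have "pderiv (birkhoff_basis_b t N j) = pderiv (birkhoff_basis_a t N j)"
    by (rule poly_eq_if_eq_on_nodes[OF assms(1)]) (use a b in \<open>auto simp: degree_pderiv\<close>)
  then obtain h where "birkhoff_basis_b t N j - birkhoff_basis_a t N j = [:h:]"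
    using pderiv_iszero[of "birkhoff_basis_b t N j - birkhoff_basis_a t N j"] by (auto simp: pderiv_diff)
  from arg_cong[OF this, of "\<lambda>p. poly p _"]
  have "poly (birkhoff_basis_b t N j) u - poly (birkhoff_basis_a t N j) u = h" for u
    by simp
  from this[of x] this[of 1] show ?thesis
    using b(2) by (simp add: birkhoff_weight_def)
qed

lemma birkhoff_interp_diff:
  assumes "inj_on t {..N}"
  shows "birkhoff_interp_b t N y y' x - birkhoff_interp_a t N y y' x =
    y 1 - y (-1) - (\<Sum>j\<le>N. birkhoff_weight t N j * y' (t j))"
proof -
  have "(\<Sum>j\<le>N. y' (t j) * poly (birkhoff_basis_b t N j) x) -
      (\<Sum>j\<le>N. y' (t j) * poly (birkhoff_basis_a t N j) x) =
      (\<Sum>j\<le>N. y' (t j) * (poly (birkhoff_basis_b t N j) x - poly (birkhoff_basis_a t N j) x))"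
    by (simp add: sum_subtractf algebra_simps)
  also have "\<dots> = - (\<Sum>j\<le>N. birkhoff_weight t N j * y' (t j))"
    by (simp add: birkhoff_basis_diff[OF assms] sum_negf algebra_simps)
  finally show ?thesis
    by (simp add: birkhoff_interp_a_def birkhoff_interp_b_def)
qed

text \<open>
  The derivatives of the basis functions form the Lagrange basis, so \<open>p\<close> is its own interpolant
  in terms of them; integrating it term by term gives the weights.
\<close>

lemma birkhoff_quadrature_exact:
  assumes "inj_on t {..N}" "degree p \<le> N"
  shows "(\<Sum>j\<le>N. birkhoff_weight t N j * poly p (t j)) = poly_integral p"
proof -
  let ?B = "birkhoff_basis_a t N"
  have "(\<Sum>j\<le>N. smult (poly p (t j)) (pderiv (?B j))) = p"
  proof (rule poly_eq_if_eq_on_nodes[OF assms(1)])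
    show "degree (\<Sum>j\<le>N. smult (poly p (t j)) (pderiv (?B j))) \<le> N"
      using birkhoff_basis_a_props(1)[OF assms(1)]
      by (intro degree_sum_le order.trans[OF degree_smult_le]) (auto simp: degree_pderiv le_diff_conv)
  next
    fix i assume i: "i \<le> N"
    have "poly (\<Sum>j\<le>N. smult (poly p (t j)) (pderiv (?B j))) (t i) =
        (\<Sum>j\<le>N. if i = j then poly p (t j) else 0)"
      unfolding poly_sum
      by (rule sum.cong) (use birkhoff_basis_a_props(3)[OF assms(1) _ i] in auto)
    then show "poly (\<Sum>j\<le>N. smult (poly p (t j)) (pderiv (?B j))) (t i) = poly p (t i)"
      using i by (simp add: sum.delta)
  qed (fact assms(2))
  then have "poly_integral p = poly_integral (\<Sum>j\<le>N. smult (poly p (t j)) (pderiv (?B j)))"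
    by simp
  also have "\<dots> = (\<Sum>j\<le>N. birkhoff_weight t N j * poly p (t j))"
    by (simp add: poly_integral_sum poly_integral_smult poly_integral_pderiv birkhoff_weight_def
        birkhoff_basis_a_props(2)[OF assms(1)] mult.commute)
  finally show ?thesis ..
qed

text \<open>
  Applied to a test polynomial that vanishes at all other nodes, the quadrature rule has a single
  term, so the sign of the weight is the sign of the integral.
\<close>

lemma birkhoff_weight_nonneg_if_test_poly:
  assumes "inj_on t {..N}" "j \<le> N" "degree q \<le> N"
    and "\<And>i. i \<le> N \<Longrightarrow> i \<noteq> j \<Longrightarrow> poly q (t i) = 0" "poly q (t j) > 0" "poly_integral q \<ge> 0"
  shows "birkhoff_weight t N j \<ge> 0"
proof -
  have "poly_integral q = (\<Sum>i\<le>N. birkhoff_weight t N i * poly q (t i))"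
    using birkhoff_quadrature_exact[OF assms(1,3)] by simp
  also have "\<dots> = (\<Sum>i\<le>N. if j = i then birkhoff_weight t N j * poly q (t j) else 0)"
    by (rule sum.cong) (use assms(4) in auto)
  also have "\<dots> = birkhoff_weight t N j * poly q (t j)"
    using assms(2) by simp
  finally show ?thesis
    using assms(5,6) by (simp add: zero_le_mult_iff)
qed

text \<open>
  For Gauss and Radau rules the square of the Lagrange numerator \<open>W\<close> is integrated exactly, which
  makes the weight nonnegative at once. A Lobatto rule is exact only up to degree \<open>2 N - 1\<close>, one less
  than the degree of that square, but its error has a known sign. Writing \<open>W\<^sup>2 = z q + r\<close>, the
  test polynomial is the remainder \<open>r\<close>, which agrees with \<open>W\<^sup>2\<close> at the nodes; by orthogonality the
  integral of \<open>z q\<close> depends only on the leading coefficient of \<open>q\<close>, and comparison with \<open>s\<close> shows that it is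
  not positive. This one statement covers all three Legendre families.
\<close>

lemma birkhoff_weight_nonneg_if_orthogonal:
  fixes z s :: "real poly"
  assumes inj: "inj_on t {..N}" and j: "j \<le> N" and N: "N \<ge> 1"
    and roots: "\<And>i. i \<le> N \<Longrightarrow> poly z (t i) = 0" and degz: "degree z = N + 1"
    and orth: "\<And>r. degree r < N - 1 \<Longrightarrow> poly_integral (z * r) = 0"
    and degs: "degree s = N - 1" and lead: "lead_coeff z * lead_coeff s > 0" and zs: "poly_integral (z * s) \<le> 0"
  shows "birkhoff_weight t N j \<ge> 0"
proof -
  define W where "W = (\<Prod>i\<in>{..N} - {j}. [:- t i, 1:])"
  define q where "q = W^2 div z"
  \<comment> \<open>subtracting \<open>c s\<close> from \<open>q\<close> leaves a polynomial of degree below \<open>N - 1\<close>, to which \<open>z\<close> is orthogonal\<close>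
  define c where "c = lead_coeff q / lead_coeff s"
  have z0: "z \<noteq> 0" and s0: "s \<noteq> 0" using lead by auto
  have W0: "W \<noteq> 0" and degW: "degree W = N"
    using j by (auto simp: W_def degree_prod_eq_sum_degree)
  have monic: "lead_coeff W = 1"
    by (simp add: W_def lead_coeff_prod)
  have W2: "degree (W^2) = 2 * N" "lead_coeff (W^2) = 1"
    by (metis degW W0 degree_power_eq, metis lead_coeff_power monic power_one)
  have mod: "degree (W^2 mod z) \<le> N"
    using degree_mod_less'[of z "W^2"] z0 degz N by (cases "W^2 mod z = 0") auto
  have W2_eq: "W^2 = z * q + W^2 mod z"
    by (simp add: q_def)
  have deg_zq: "degree (z * q) = 2 * N" and lead_zq: "lead_coeff (z * q) = 1"
  proof -
    have eq: "z * q = W^2 - W^2 mod z" by (simp add: q_def minus_mod_eq_mult_div)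
    have lt: "degree (W^2 mod z) < degree (W^2)" using mod W2 N by linarith
    show "degree (z * q) = 2 * N"
      unfolding eq using degree_add_eq_left[of "- (W^2 mod z)" "W^2"] lt W2(1) by simp
    then have "lead_coeff (z * q) = coeff (W^2) (2 * N) - coeff (W^2 mod z) (2 * N)"
      unfolding eq by (simp only: coeff_diff)
    then show "lead_coeff (z * q) = 1"
      using coeff_eq_0[OF lt] W2 by (simp only: diff_zero)
  qed
  have q0: "q \<noteq> 0" using lead_zq by auto
  have degq: "degree q = N - 1"
    using deg_zq degz z0 q0 by (simp add: degree_mult_eq)
  have "lead_coeff z * lead_coeff q = 1"
    using lead_zq by (simp add: lead_coeff_mult)
  then have "lead_coeff z * lead_coeff q > 0"
    by (simp only: zero_less_one)
  with lead have c: "c > 0"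
    unfolding c_def zero_less_mult_iff zero_less_divide_iff by argo
  have "poly_integral (z * (q - smult c s)) = 0"
  proof (cases "q - smult c s = 0")
    case False
    have "lead_coeff s \<noteq> 0" using s0 by simp
    then have "coeff (q - smult c s) (N - 1) = 0"
      unfolding degs c_def degq by simp
    moreover have "degree (q - smult c s) \<le> N - 1"
      using degq degs by (intro degree_diff_le order.trans[OF degree_smult_le]) auto
    ultimately have "degree (q - smult c s) < N - 1"
      using False leading_coeff_0_iff[of "q - smult c s"] by (cases "degree (q - smult c s) = N - 1") auto
    then show ?thesis by (rule orth)
  qed simp
  then have "poly_integral (z * q) = c * poly_integral (z * s)"
    by (simp add: algebra_simps poly_integral_diff poly_integral_smult)
  then have "poly_integral (z * q) \<le> 0"
    using c zs by (simp add: mult_le_0_iff)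
  moreover have "poly_integral (W^2) \<ge> 0"
    by (rule poly_integral_nonneg) simp
  ultimately have int: "poly_integral (W^2 mod z) \<ge> 0"
    using poly_integral_add[of "z * q" "W^2 mod z", folded W2_eq] by linarith
  have at_nodes: "poly (W^2 mod z) (t i) = (poly W (t i))^2" if "i \<le> N" for i
    using arg_cong[OF W2_eq, of "\<lambda>p. poly p (t i)"] roots[OF that] by simp
  have "poly W (t i) = 0" if "i \<le> N" "i \<noteq> j" for i
    using that by (auto simp: W_def poly_prod)
  moreover have "poly W (t j) \<noteq> 0"
    using inj j by (auto simp: W_def poly_prod inj_on_def)
  ultimately show ?thesis
    using j by (intro birkhoff_weight_nonneg_if_test_poly[OF inj j mod _ _ int]) (auto simp: at_nodes)
qed

section \<open>Convergence of positive quadrature rules\<close>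

text \<open>
  The \<open>k\<close>-th of \<open>m\<close> equal pieces of \<open>[-1, 1]\<close>, counted from \<open>0\<close>. The pieces are closed, as a
  tagged division requires, so neighbours share an endpoint.
\<close>

definition piece :: "nat \<Rightarrow> nat \<Rightarrow> real set" where
  "piece m k = {-1 + 2 * real k / real m .. -1 + 2 * real (Suc k) / real m}"

lemma measure_piece: "m > 0 \<Longrightarrow> measure lborel (piece m k) = 2 / real m"
  by (simp add: piece_def field_simps)

lemma piece_subset: "k < m \<Longrightarrow> piece m k \<subseteq> {-1..1}"
  by (auto simp: piece_def field_simps)

lemma in_some_piece:
  assumes "m > 0" "x \<in> {-1..1}"
  shows "\<exists>k<m. x \<in> piece m k"
proof (cases "x = 1")
  case True
  then show ?thesis
    using assms(1) by (intro exI[of _ "m - 1"]) (auto simp: piece_def of_nat_diff field_simps)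
next
  case False
  define u where "u = (x + 1) * real m / 2"
  have u: "0 \<le> u" "u < real m"
    using assms mult_strict_right_mono[of x 1 "real m"] mult_right_mono[of "-1" x "real m"] False by (auto simp: u_def algebra_simps)
  have "real (nat \<lfloor>u\<rfloor>) \<le> u" "u \<le> real (nat \<lfloor>u\<rfloor>) + 1"
    using u(1) by linarith+
  moreover have "x = -1 + 2 * u / real m"
    using assms(1) by (simp add: u_def)
  ultimately have "x \<in> piece m (nat \<lfloor>u\<rfloor>)"
    using assms(1) by (auto simp: piece_def field_simps)
  moreover have "nat \<lfloor>u\<rfloor> < m"
    using u by linarith
  ultimately show ?thesis by blast
qed

lemma inj_piece: "m > 0 \<Longrightarrow> inj_on (piece m) A"
  by (auto simp: inj_on_def piece_def Icc_eq_Icc field_simps)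

lemma tagged_division_pieces:
  assumes m: "m > 0" and x: "\<And>k. k < m \<Longrightarrow> x k \<in> piece m k"
  shows "((\<lambda>k. (x k, piece m k)) ` {..<m}) tagged_division_of {-1..1}"
proof (rule tagged_division_ofI)
  show "finite ((\<lambda>k. (x k, piece m k)) ` {..<m})" by simp
next
  fix u K assume "(u, K) \<in> (\<lambda>k. (x k, piece m k)) ` {..<m}"
  then obtain k where k: "k < m" "u = x k" "K = piece m k" by auto
  show "u \<in> K" using x k by simp
  show "K \<subseteq> {-1..1}" using piece_subset k by simp
  show "\<exists>a b. K = cbox a b" using k(3) by (auto simp: piece_def)
next
  fix u1 K1 u2 K2
  assume "(u1, K1) \<in> (\<lambda>k. (x k, piece m k)) ` {..<m}" "(u2, K2) \<in> (\<lambda>k. (x k, piece m k)) ` {..<m}"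
    "(u1, K1) \<noteq> (u2, K2)"
  then obtain k l where kl: "K1 = piece m k" "K2 = piece m l" "k \<noteq> l" by auto
  have *: "interior (piece m k) \<inter> interior (piece m l) = {}" if "k < l" for k l
  proof -
    have "real (Suc k) \<le> real l" using that by simp
    then have "-1 + 2 * real (Suc k) / real m \<le> -1 + 2 * real l / real m"
      by (intro add_left_mono divide_right_mono mult_left_mono) auto
    then show ?thesis by (auto simp: piece_def)
  qed
  show "interior K1 \<inter> interior K2 = {}"
    using *[of k l] *[of l k] kl by (cases "k < l") auto
next
  show "\<Union>{K. \<exists>u. (u, K) \<in> (\<lambda>k. (x k, piece m k)) ` {..<m}} = {-1..1}"
    using in_some_piece[OF m] piece_subset by fast
qed

lemma fine_pieces:
  assumes m: "m > 0" "2 / real m < d" and x: "\<And>k. k < m \<Longrightarrow> x k \<in> piece m k"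
  shows "(\<lambda>x. ball x d) fine ((\<lambda>k. (x k, piece m k)) ` {..<m})"
proof (rule fineI)
  fix u K assume "(u, K) \<in> (\<lambda>k. (x k, piece m k)) ` {..<m}"
  then obtain k where k: "k < m" "u = x k" "K = piece m k" by auto
  have "2 * real (Suc k) / real m = 2 * real k / real m + 2 / real m"
    by (simp add: add_divide_distrib)
  then have "\<bar>v - u\<bar> \<le> 2 / real m" if "v \<in> K" for v
    using that x[OF k(1)] k unfolding piece_def by auto
  then show "K \<subseteq> ball u d"
    using m(2) by (force simp: dist_real_def abs_minus_commute)
qed

text \<open>
  The variant of \<open>riemann_integrable\<close> on \<open>[-1, 1]\<close> that names the value of the integral.
\<close>

definition has_riemann_integral :: "(real \<Rightarrow> real) \<Rightarrow> real \<Rightarrow> bool" where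
  "has_riemann_integral f I \<longleftrightarrow> (\<forall>e>0. \<exists>d>0. \<forall>p.
     p tagged_division_of {-1..1} \<and> (\<lambda>x. ball x d) fine p \<longrightarrow>
       \<bar>(\<Sum>(x, k)\<in>p. measure lborel k * f x) - I\<bar> < e)"

lemma has_riemann_integralE:
  assumes "has_riemann_integral f I" "e > 0"
  obtains d where "d > 0"
    "\<And>p. p tagged_division_of {-1..1} \<Longrightarrow> (\<lambda>x. ball x d) fine p \<Longrightarrow>
       \<bar>(\<Sum>(x, k)\<in>p. measure lborel k * f x) - I\<bar> < e"
proof -
  from assms have "\<exists>d>0. \<forall>p. p tagged_division_of {-1..1} \<and> (\<lambda>x. ball x d) fine p \<longrightarrow>
       \<bar>(\<Sum>(x, k)\<in>p. measure lborel k * f x) - I\<bar> < e"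
    unfolding has_riemann_integral_def by (elim allE impE)
  then show thesis
    using that by (elim exE conjE) (simp only: conj_imp_eq_imp_imp)
qed

lemma has_riemann_integral_minus:
  assumes "has_riemann_integral f I"
  shows "has_riemann_integral (\<lambda>x. - f x) (- I)"
proof -
  have neg: "(\<Sum>(x, k)\<in>p. measure lborel k * - f x) = - (\<Sum>(x, k)\<in>p. measure lborel k * f x)" for p
    by (simp add: split_def sum_negf)
  have "\<bar>- s - - I\<bar> = \<bar>s - I\<bar>" for s by linarith
  then show ?thesis
    using assms unfolding has_riemann_integral_def neg by (simp only:)
qed

lemma uniform_riemann_sums:
  assumes "has_riemann_integral f I" "e > 0"
  shows "\<exists>m>0. \<forall>x. (\<forall>k<m. x k \<in> piece m k) \<longrightarrow> \<bar>(\<Sum>k<m. 2 / real m * f (x k)) - I\<bar> < e"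
proof -
  obtain d where d: "d > 0" "\<And>p. p tagged_division_of {-1..1} \<Longrightarrow> (\<lambda>x. ball x d) fine p \<Longrightarrow>
       \<bar>(\<Sum>(x, k)\<in>p. measure lborel k * f x) - I\<bar> < e"
    using has_riemann_integralE[OF assms] by metis
  obtain m where "real m > 2 / d"
    using reals_Archimedean2 by blast
  moreover from this have "m > 0"
    using d(1) by (cases m) (auto simp: field_simps)
  ultimately have m: "m > 0" "2 / real m < d"
    using d(1) by (auto simp: field_simps)
  have "\<bar>(\<Sum>k<m. 2 / real m * f (x k)) - I\<bar> < e" if x: "\<forall>k<m. x k \<in> piece m k" for x
  proof -
    have "(\<Sum>(u, K)\<in>(\<lambda>k. (x k, piece m k)) ` {..<m}. measure lborel K * f u) =
        (\<Sum>k<m. 2 / real m * f (x k))"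
      using inj_piece[OF m(1)]
      by (subst sum.reindex) (auto simp: inj_on_def measure_piece[OF m(1)])
    then show ?thesis
      using d(2)[OF tagged_division_pieces fine_pieces, of m x] x m by simp
  qed
  then show ?thesis using m by blast
qed

text \<open>
  In a partition whose Riemann sums all lie within \<open>1\<close> of the integral, moving a single tag changes the
  sum by less than \<open>2\<close>, which bounds the difference of two function values in one piece.
\<close>

lemma riemann_bounded:
  assumes "has_riemann_integral f I"
  shows "\<exists>M>0. \<forall>x\<in>{-1..1}. \<bar>f x\<bar> \<le> M"
proof -
  obtain m where m: "m > 0" and
    sums: "\<And>x. (\<And>k. k < m \<Longrightarrow> x k \<in> piece m k) \<Longrightarrow> \<bar>(\<Sum>k<m. 2 / real m * f (x k)) - I\<bar> < 1"
    using uniform_riemann_sums[OF assms, of 1] by auto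
  define l where "l k = -1 + 2 * real k / real m" for k
  have l: "l k \<in> piece m k" for k
    using m by (auto simp: l_def piece_def field_simps)
  define M where "M = (\<Sum>k<m. \<bar>f (l k)\<bar>) + real m"
  have "\<bar>f x\<bar> \<le> M" if "x \<in> {-1..1}" for x
  proof -
    obtain k where k: "k < m" "x \<in> piece m k"
      using in_some_piece[OF m \<open>x \<in> {-1..1}\<close>] by blast
    have "\<bar>(\<Sum>i<m. 2 / real m * f (l i)) - I\<bar> < 1" "\<bar>(\<Sum>i<m. 2 / real m * f ((l(k := x)) i)) - I\<bar> < 1"
      using sums[of l] sums[of "l(k := x)"] l k(2) by simp_all
    moreover have "(\<Sum>i<m. 2 / real m * f ((l(k := x)) i)) - (\<Sum>i<m. 2 / real m * f (l i)) =
        (\<Sum>i<m. if k = i then 2 / real m * (f x - f (l k)) else 0)"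
      unfolding sum_subtractf[symmetric] by (rule sum.cong) (auto simp: algebra_simps diff_divide_distrib)
    ultimately have "\<bar>2 / real m * (f x - f (l k))\<bar> < 2"
      using k(1) by simp
    then have "\<bar>f x - f (l k)\<bar> < real m"
      using m by (simp add: abs_mult field_simps)
    moreover have "\<bar>f (l k)\<bar> \<le> (\<Sum>k<m. \<bar>f (l k)\<bar>)"
      using k(1) by (intro member_le_sum) auto
    ultimately show ?thesis by (simp add: M_def)
  qed
  moreover have "M > 0"
    using m by (auto simp: M_def intro!: add_nonneg_pos sum_nonneg)
  ultimately show ?thesis by blast
qed

text \<open>
  A polynomial upper bound for the indicator function of \<open>[a, b]\<close> with almost the same integral:
  a trapezoidal bump with ramps of width \<open>h\<close>, approximated by Weierstrass to within \<open>h\<close> and raised by \<open>h\<close>. The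
  ramps cost \<open>2 h\<close> and the approximation \<open>4 h\<close>, whence \<open>h = \<delta> / 6\<close>.
\<close>

lemma poly_majorant_of_interval:
  fixes a b :: real
  assumes "\<delta> > 0" "a \<le> b"
  shows "\<exists>p. (\<forall>x\<in>{-1..1}. 0 \<le> poly p x) \<and> (\<forall>x\<in>{-1..1} \<inter> {a..b}. 1 \<le> poly p x) \<and> poly_integral p \<le> b - a + \<delta>"
proof -
  define h where "h = \<delta> / 6"
  have h: "h > 0" using assms by (simp add: h_def)
  define g where "g x = max 0 (min 1 (min ((x - a) / h + 1) ((b - x) / h + 1)))" for x
  have cont: "continuous_on A g" for A
    unfolding g_def using h by (intro continuous_intros) auto
  have g0: "g x = 0" if "x \<notin> {a - h..b + h}" for x
  proof -
    have "(x - a) / h + 1 < 0 \<or> (b - x) / h + 1 < 0"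
      using that h by (auto simp: field_simps)
    then show ?thesis by (auto simp: g_def)
  qed
  have g1: "g x = 1" if "x \<in> {a..b}" for x
    using that h by (auto simp: g_def max_def min_def field_simps)
  have g_range: "0 \<le> g x" "g x \<le> 1" for x
    by (auto simp: g_def)
  obtain G where G: "real_polynomial_function G" "\<And>x. x \<in> {-1..1} \<Longrightarrow> \<bar>g x - G x\<bar> < h"
    using Stone_Weierstrass_real_polynomial_function[OF compact_Icc cont h] by blast
  obtain c n where c: "G = (\<lambda>x. \<Sum>i\<le>n. c i * x ^ i)"
    using G(1) unfolding real_polynomial_function_iff_sum by blast
  define p where "p = [:h:] + (\<Sum>i\<le>n. monom (c i) i)"
  have p: "poly p x = G x + h" for x
    by (simp add: p_def c poly_sum poly_monom)
  have near: "g x \<le> poly p x" "poly p x \<le> g x + 2 * h" if "x \<in> {-1..1}" for x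
    using G(2)[OF that] by (auto simp: p)
  have "poly_integral p \<le> integral {-1..1} (\<lambda>x. g x + 2 * h)"
    unfolding poly_integral_def
    by (rule integral_le) (auto simp: near intro!: integrable_continuous_interval continuous_intros cont)
  also have "\<dots> = integral {-1..1} g + 4 * h"
    by (subst integral_add) (auto intro!: integrable_continuous_interval cont)
  also have "integral {-1..1} g \<le> integral (cbox (a - h) (b + h)) (\<lambda>x. 1)"
  proof -
    have "integral {-1..1} g = integral ({-1..1} \<inter> {a - h..b + h}) g"
      by (rule integral_spike_set) (auto intro!: negligible_subset[OF negligible_empty] simp: g0)
    also have "\<dots> \<le> integral {a - h..b + h} g"
      unfolding Int_atLeastAtMost
      by (rule integral_subset_le) (auto intro!: integrable_continuous_interval cont g_range)
    also have "\<dots> \<le> integral {a - h..b + h} (\<lambda>x. 1)"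
      by (rule integral_le) (auto intro!: integrable_continuous_interval cont g_range)
    finally show ?thesis by simp
  qed
  also have "\<dots> = b - a + 2 * h"
    using h assms(2) by simp
  finally have "poly_integral p \<le> b - a + \<delta>"
    by (simp add: h_def)
  moreover have "0 \<le> poly p x" if "x \<in> {-1..1}" for x
    using near(1)[OF that] g_range(1)[of x] by linarith
  moreover have "1 \<le> poly p x" if "x \<in> {-1..1} \<inter> {a..b}" for x
    using near(1)[of x] g1[of x] that by auto
  ultimately show ?thesis by blast
qed

text \<open>
  A sequence of quadrature rules on \<open>[-1, 1]\<close>: the rule with index \<open>N\<close> has the nodes \<open>t N 0, \<dots>, t N N\<close>
  and the weights \<open>w N 0, \<dots>, w N N\<close>.
\<close>

locale positive_quadrature =
  fixes t w :: "nat \<Rightarrow> nat \<Rightarrow> real"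
  assumes node_in: "N \<ge> 1 \<Longrightarrow> j \<le> N \<Longrightarrow> t N j \<in> {-1..1}"
    and weight_nonneg: "N \<ge> 1 \<Longrightarrow> j \<le> N \<Longrightarrow> 0 \<le> w N j"
    and exact: "N \<ge> 1 \<Longrightarrow> degree p \<le> N \<Longrightarrow> (\<Sum>j\<le>N. w N j * poly p (t N j)) = poly_integral p"
begin

lemma weight_sum: "N \<ge> 1 \<Longrightarrow> (\<Sum>j\<le>N. w N j) = 2"
  using exact[of N 1] poly_integral_pderiv[of "[:0, 1:]"] by (simp add: pderiv_pCons one_pCons)

text \<open>
  Nonnegative weights allow the indicator function to be replaced by a polynomial majorant, for
  which the rule is eventually exact.
\<close>

lemma eventually_mass_le:
  assumes "\<delta> > 0" "a \<le> b"
  shows "\<forall>\<^sub>F N in sequentially. (\<Sum>j | j \<le> N \<and> t N j \<in> {a..b}. w N j) \<le> b - a + \<delta>"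
proof -
  obtain p where p: "\<And>x. x \<in> {-1..1} \<Longrightarrow> 0 \<le> poly p x"
    "\<And>x. x \<in> {-1..1} \<inter> {a..b} \<Longrightarrow> 1 \<le> poly p x" "poly_integral p \<le> b - a + \<delta>"
    using poly_majorant_of_interval[OF assms] by blast
  have "(\<Sum>j | j \<le> N \<and> t N j \<in> {a..b}. w N j) \<le> b - a + \<delta>" if N: "N \<ge> max 1 (degree p)" for N
  proof -
    have "(\<Sum>j | j \<le> N \<and> t N j \<in> {a..b}. w N j) \<le> (\<Sum>j | j \<le> N \<and> t N j \<in> {a..b}. w N j * poly p (t N j))"
    proof (rule sum_mono)
      fix j assume "j \<in> {j. j \<le> N \<and> t N j \<in> {a..b}}"
      then have "1 \<le> poly p (t N j)" "0 \<le> w N j"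
        using N node_in[of N j] weight_nonneg[of N j] p(2) by auto
      then show "w N j \<le> w N j * poly p (t N j)"
        using mult_left_mono[of 1 "poly p (t N j)" "w N j"] by simp
    qed
    also have "\<dots> \<le> (\<Sum>j\<le>N. w N j * poly p (t N j))"
      using N node_in[of N] weight_nonneg[of N] p(1) by (intro sum_mono2) auto
    also have "\<dots> = poly_integral p"
      using N by (intro exact) auto
    finally show ?thesis using p(3) by simp
  qed
  then show ?thesis
    unfolding eventually_sequentially by blast
qed

text \<open>
  Partition \<open>[-1, 1]\<close> into \<open>m\<close> pieces so fine that all Riemann sums are close to \<open>I\<close>, assign every
  node to one piece containing it, and replace each value of \<open>f\<close> by its maximum over the nodes of the same piece.
  The result is a Riemann sum in which the length \<open>2 / m\<close> of the piece \<open>k\<close> is replaced by its mass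
  \<open>\<mu> k\<close>. Only an upper bound \<open>2 / m + \<delta>\<close> for each mass is known, but since the masses add up to \<open>2\<close> they
  cannot fall short by much either: the nonnegative gaps \<open>2 / m + \<delta> - \<mu> k\<close> have the sum \<open>m \<delta>\<close>.
\<close>

lemma eventually_sum_le:
  assumes f: "has_riemann_integral f I" and "e > 0"
  shows "\<forall>\<^sub>F N in sequentially. (\<Sum>j\<le>N. w N j * f (t N j)) \<le> I + e"
proof -
  obtain M where M: "M > 0" "\<And>x. x \<in> {-1..1} \<Longrightarrow> \<bar>f x\<bar> \<le> M"
    using riemann_bounded[OF f] by blast
  obtain m where m: "m > 0" and
    sums: "\<And>x. (\<And>k. k < m \<Longrightarrow> x k \<in> piece m k) \<Longrightarrow> \<bar>(\<Sum>k<m. 2 / real m * f (x k)) - I\<bar> < e / 2"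
    using uniform_riemann_sums[OF f, of "e / 2"] \<open>e > 0\<close> by auto
  \<comment> \<open>chosen so that the accumulated error \<open>2 m \<delta> M\<close> is \<open>e / 2\<close>\<close>
  define \<delta> where "\<delta> = e / (4 * real m * M)"
  have \<delta>: "\<delta> > 0" using \<open>e > 0\<close> M m by (simp add: \<delta>_def)
  have "\<forall>\<^sub>F N in sequentially. \<forall>k\<in>{..<m}. (\<Sum>j | j \<le> N \<and> t N j \<in> piece m k. w N j) \<le> 2 / real m + \<delta>"
  proof (rule eventually_ball_finite)
    show "\<forall>k\<in>{..<m}. \<forall>\<^sub>F N in sequentially. (\<Sum>j | j \<le> N \<and> t N j \<in> piece m k. w N j) \<le> 2 / real m + \<delta>"
    proof
      fix k
      let ?a = "-1 + 2 * real k / real m" and ?b = "-1 + 2 * real (Suc k) / real m"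
      have ab: "?b - ?a = 2 / real m"
        by (simp add: add_divide_distrib)
      then have "?a \<le> ?b"
        by (smt (verit) divide_nonneg_nonneg of_nat_0_le_iff)
      from eventually_mass_le[OF \<delta> this]
      show "\<forall>\<^sub>F N in sequentially. (\<Sum>j | j \<le> N \<and> t N j \<in> piece m k. w N j) \<le> 2 / real m + \<delta>"
        unfolding piece_def ab .
    qed
  qed simp
  moreover have "\<forall>\<^sub>F N in sequentially. N \<ge> 1"
    by (rule eventually_ge_at_top)
  ultimately show ?thesis
  proof eventually_elim
    case (elim N)
    note mass = elim(1) and N = elim(2)
    have "\<forall>j\<in>{..N}. \<exists>k<m. t N j \<in> piece m k"
      using node_in[OF N] in_some_piece[OF m] by auto
    then obtain \<kappa> where \<kappa>: "\<And>j. j \<le> N \<Longrightarrow> \<kappa> j < m" "\<And>j. j \<le> N \<Longrightarrow> t N j \<in> piece m (\<kappa> j)"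
      by (metis atMost_iff)
    define J where "J k = {j. j \<le> N \<and> \<kappa> j = k}" for k
    define \<mu> where "\<mu> k = (\<Sum>j\<in>J k. w N j)" for k
    have "\<exists>x. x \<in> piece m k \<and> (\<forall>j\<in>J k. f (t N j) \<le> f x)" for k
    proof (cases "J k = {}")
      case True
      have "-1 + 2 * real k / real m \<in> piece m k"
        using m by (auto simp: piece_def field_simps)
      with True show ?thesis by blast
    next
      case False
      let ?V = "(\<lambda>j. f (t N j)) ` J k"
      have fin: "finite ?V" by (simp add: J_def)
      then have "Max ?V \<in> ?V" using False by (intro Max_in) auto
      then obtain j where "j \<in> J k" "f (t N j) = Max ?V" by auto
      moreover from this fin have "\<forall>i\<in>J k. f (t N i) \<le> f (t N j)" by simp
      ultimately have "j \<in> J k" "\<forall>i\<in>J k. f (t N i) \<le> f (t N j)" by blast+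
      then show ?thesis
        using \<kappa>(2) by (auto simp: J_def)
    qed
    then obtain x where x: "\<And>k. x k \<in> piece m k" "\<And>k j. j \<in> J k \<Longrightarrow> f (t N j) \<le> f (x k)"
      by metis
    have group: "(\<Sum>j\<le>N. g j) = (\<Sum>k<m. \<Sum>j\<in>J k. g j)" for g :: "nat \<Rightarrow> real"
    proof -
      have "\<kappa> ` {..N} \<subseteq> {..<m}" using \<kappa>(1) by auto
      from sum.group[OF _ _ this, of g] show ?thesis by (simp add: J_def)
    qed
    have \<mu>_le: "\<mu> k \<le> 2 / real m + \<delta>" if "k < m" for k
    proof -
      have "\<mu> k \<le> (\<Sum>j | j \<le> N \<and> t N j \<in> piece m k. w N j)"
        unfolding \<mu>_def J_def using \<kappa> weight_nonneg[OF N] by (intro sum_mono2) auto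
      then show ?thesis using mass that by force
    qed
    have \<mu>_sum: "(\<Sum>k<m. \<mu> k) = 2"
      using group[of "w N"] weight_sum[OF N] by (simp add: \<mu>_def)
    have "(\<Sum>j\<le>N. w N j * f (t N j)) \<le> (\<Sum>k<m. \<Sum>j\<in>J k. w N j * f (x k))"
      unfolding group
      by (intro sum_mono mult_left_mono x(2) weight_nonneg[OF N]) (auto simp: J_def)
    also have "\<dots> = (\<Sum>k<m. \<mu> k * f (x k))"
      by (simp add: \<mu>_def sum_distrib_right)
    also have "\<dots> \<le> (\<Sum>k<m. 2 / real m * f (x k) + M * (2 / real m + 2 * \<delta> - \<mu> k))"
    proof (rule sum_mono)
      fix k assume "k \<in> {..<m}"
      then have k: "k < m" by simp
      have "\<bar>f (x k)\<bar> \<le> M"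
        using x(1)[of k] piece_subset[OF k] M(2) by blast
      \<comment> \<open>the deviation of \<open>\<mu> k\<close> from \<open>2 / m\<close> is at most \<open>\<delta>\<close> plus the gap \<open>2 / m + \<delta> - \<mu> k\<close>\<close>
      moreover have "\<bar>\<mu> k - 2 / real m\<bar> \<le> 2 / real m + 2 * \<delta> - \<mu> k"
        using \<mu>_le[OF k] \<delta> by linarith
      ultimately have "\<bar>\<mu> k - 2 / real m\<bar> * \<bar>f (x k)\<bar> \<le> (2 / real m + 2 * \<delta> - \<mu> k) * M"
        by (intro mult_mono) auto
      then have "(\<mu> k - 2 / real m) * f (x k) \<le> (2 / real m + 2 * \<delta> - \<mu> k) * M"
        using abs_ge_self[of "(\<mu> k - 2 / real m) * f (x k)"] by (simp add: abs_mult)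
      then show "\<mu> k * f (x k) \<le> 2 / real m * f (x k) + M * (2 / real m + 2 * \<delta> - \<mu> k)"
        by (simp add: algebra_simps)
    qed
    also have "\<dots> = (\<Sum>k<m. 2 / real m * f (x k)) + M * (\<Sum>k<m. 2 / real m + 2 * \<delta> - \<mu> k)"
      by (simp only: sum.distrib sum_distrib_left)
    also have "(\<Sum>k<m. 2 / real m + 2 * \<delta> - \<mu> k) = 2 * real m * \<delta>"
      using m by (simp add: sum_subtractf \<mu>_sum distrib_left)
    also have "M * (2 * real m * \<delta>) = e / 2"
      using M(1) m by (simp add: \<delta>_def)
    also have "(\<Sum>k<m. 2 / real m * f (x k)) < I + e / 2"
      using sums[OF x(1)] by linarith
    finally show ?case by simp
  qed
qed

text \<open>
  The lower bound is the upper bound for \<open>- f\<close>.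
\<close>

theorem converges:
  assumes f: "has_riemann_integral f I"
  shows "(\<lambda>N. \<Sum>j\<le>N. w N j * f (t N j)) \<longlonglongrightarrow> I"
proof (rule tendstoI)
  fix e :: real assume "e > 0"
  then have e: "e / 2 > 0" by simp
  show "\<forall>\<^sub>F N in sequentially. dist (\<Sum>j\<le>N. w N j * f (t N j)) I < e"
    using eventually_sum_le[OF f e] eventually_sum_le[OF has_riemann_integral_minus[OF f] e]
  proof eventually_elim
    case (elim N)
    then show ?case
      using \<open>e > 0\<close> by (simp add: dist_real_def sum_negf abs_less_iff)
  qed
qed

end

text \<open>
  A Riemann integral is in particular a Henstock-Kurzweil integral, with gauge the balls of
  constant radius, and for the latter the fundamental theorem of calculus holds for every derivative.
\<close>

lemma has_riemann_integral_derivative: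
  assumes "\<And>x. x \<in> {-1..1} \<Longrightarrow> (y has_real_derivative y' x) (at x within {-1..1})"
    and "riemann_integrable y' (-1) 1"
  shows "has_riemann_integral y' (y 1 - y (-1))"
proof -
  obtain I where I: "has_riemann_integral y' I"
    using assms(2) unfolding riemann_integrable_def has_riemann_integral_def by blast
  have "(y' has_integral I) (cbox (-1) 1)"
    unfolding has_integral
  proof (intro allI impI)
    fix e :: real assume "e > 0"
    then obtain d where d: "d > 0" "\<And>p. p tagged_division_of {-1..1} \<Longrightarrow> (\<lambda>x. ball x d) fine p \<Longrightarrow>
        \<bar>(\<Sum>(x, k)\<in>p. measure lborel k * y' x) - I\<bar> < e"
      using has_riemann_integralE[OF I] by metis
    then show "\<exists>\<gamma>. gauge \<gamma> \<and> (\<forall>\<D>. \<D> tagged_division_of cbox (-1) 1 \<and> \<gamma> fine \<D> \<longrightarrow>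
        norm ((\<Sum>(x, k)\<in>\<D>. measure lborel k *\<^sub>R y' x) - I) < e)"
      by (intro exI[of _ "\<lambda>x. ball x d"]) auto
  qed
  moreover have "(y' has_integral (y 1 - y (-1))) (cbox (-1) 1)"
    unfolding box_real using assms(1)
    by (intro fundamental_theorem_of_calculus) (auto simp flip: has_real_derivative_iff_has_vector_derivative)
  ultimately have "I = y 1 - y (-1)"
    by (rule has_integral_unique)
  with I show ?thesis by simp
qed

section \<open>Legendre grids\<close>

text \<open>
  Rolle's theorem between consecutive roots, by induction on their number: the largest root
  is split off, and the new root of the derivative lies between it and the next largest one.
\<close>

lemma rolle_roots:
  fixes p :: "real poly"
  assumes "finite S" "card S = Suc n" "S \<subseteq> {a..b}" "\<And>x. x \<in> S \<Longrightarrow> poly p x = 0"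
  shows "\<exists>T. finite T \<and> card T = n \<and> T \<subseteq> {a<..<b} \<and> (\<forall>x\<in>T. poly (pderiv p) x = 0)"
  using assms
proof (induction n arbitrary: S b)
  case 0
  then show ?case by (intro exI[of _ "{}"]) auto
next
  case (Suc n)
  define M where "M = Max S"
  define S' where "S' = S - {M}"
  define M' where "M' = Max S'"
  have "S \<noteq> {}" using Suc.prems by auto
  then have M: "M \<in> S" "\<And>x. x \<in> S \<Longrightarrow> x \<le> M" using Suc.prems(1) by (auto simp: M_def)
  have S': "finite S'" "card S' = Suc n" using M Suc.prems by (auto simp: S'_def)
  then have "S' \<noteq> {}" by auto
  then have M': "M' \<in> S'" "\<And>x. x \<in> S' \<Longrightarrow> x \<le> M'" using S'(1) by (auto simp: M'_def)
  have "M' < M" using M M'(1) by (force simp: S'_def)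
  then obtain c where c: "M' < c" "c < M" "poly p M - poly p M' = (M - M') * poly (pderiv p) c"
    using poly_MVT by blast
  moreover have "poly p M = 0" "poly p M' = 0"
    using Suc.prems(4) M(1) M'(1) by (auto simp: S'_def)
  ultimately have root: "poly (pderiv p) c = 0" using \<open>M' < M\<close> by simp
  obtain T where T: "finite T" "card T = n" "T \<subseteq> {a<..<M'}" "\<forall>x\<in>T. poly (pderiv p) x = 0"
  proof -
    have "S' \<subseteq> {a..M'}"
    proof
      fix x assume x: "x \<in> S'"
      then have "x \<in> {a..b}" using Suc.prems(3) by (auto simp: S'_def)
      then show "x \<in> {a..M'}" using M'(2)[OF x] by simp
    qed
    moreover have "poly p x = 0" if "x \<in> S'" for x using that Suc.prems(4) by (simp add: S'_def)
    ultimately show thesis using Suc.IH[OF S'] that by blast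
  qed
  have "a \<le> M'" "M \<le> b" using M(1) M'(1) Suc.prems(3) by (auto simp: S'_def)
  with T c root show ?case
    by (intro exI[of _ "insert c T"]) (auto simp: card_insert_if)
qed

lemma power_dvd_pderiv:
  fixes q p :: "real poly"
  assumes "q ^ Suc m dvd p"
  shows "q ^ m dvd pderiv p"
proof -
  obtain r where r: "p = q ^ Suc m * r" using assms by (elim dvdE)
  have "pderiv p = q ^ m * (q * pderiv r + r * smult (of_nat (Suc m)) (pderiv q))"
    unfolding r pderiv_mult pderiv_power_Suc by (simp add: algebra_simps)
  then show ?thesis by simp
qed

lemma power_dvd_higher_pderiv:
  fixes q p :: "real poly"
  assumes "q ^ n dvd p" "k \<le> n"
  shows "q ^ (n - k) dvd (pderiv ^^ k) p"
  using assms(2)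
proof (induction k)
  case (Suc k)
  then have "q ^ Suc (n - Suc k) dvd (pderiv ^^ k) p" by (simp add: Suc_diff_Suc)
  then show ?case using power_dvd_pderiv by simp
qed (use assms(1) in simp)

lemma higher_pderiv_endpoints:
  assumes "[:-1, 0, 1:] ^ n dvd (V :: real poly)" "k < n"
  shows "poly ((pderiv ^^ k) V) 1 = 0" "poly ((pderiv ^^ k) V) (-1) = 0"
proof -
  have "[:-1, 0, 1:] dvd [:-1, 0, 1::real:] ^ (n - k)"
    using assms(2) by (intro dvd_power) auto
  also have "\<dots> dvd (pderiv ^^ k) V"
    using power_dvd_higher_pderiv[OF assms(1)] assms(2) by simp
  finally obtain r where "(pderiv ^^ k) V = [:-1, 0, 1:] * r" by (elim dvdE)
  then show "poly ((pderiv ^^ k) V) 1 = 0" "poly ((pderiv ^^ k) V) (-1) = 0" by simp_all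
qed

text \<open>
  Each differentiation up to the \<open>n\<close>-th gains one interior root, because the endpoints are still roots of
  the polynomial being differentiated.
\<close>

lemma higher_pderiv_interior_roots:
  assumes "[:-1, 0, 1:] ^ n dvd (V :: real poly)" "k \<le> n"
  shows "\<exists>T. finite T \<and> card T = k \<and> T \<subseteq> {-1<..<1} \<and> (\<forall>x\<in>T. poly ((pderiv ^^ k) V) x = 0)"
  using assms(2)
proof (induction k)
  case 0
  then show ?case by (intro exI[of _ "{}"]) auto
next
  case (Suc k)
  then obtain T where T: "finite T" "card T = k" "T \<subseteq> {-1<..<1}" "\<forall>x\<in>T. poly ((pderiv ^^ k) V) x = 0"
    by auto
  then have "-1 \<notin> T" "1 \<notin> T" by auto
  with T have "card (insert (-1) (insert 1 T)) = Suc (Suc k)" by simp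
  moreover have "insert (-1) (insert 1 T) \<subseteq> {-1..1}" using T(3) by auto
  ultimately show ?case
    using rolle_roots[of "insert (-1) (insert 1 T)" "Suc k" "-1" 1 "(pderiv ^^ k) V"] T
      higher_pderiv_endpoints[OF assms(1), of k] Suc.prems by auto
qed

text \<open>
  Repeated integration by parts; the boundary terms vanish at the endpoints.
\<close>

lemma higher_pderiv_orthogonal:
  assumes "[:-1, 0, 1:] ^ n dvd (V :: real poly)" "m \<le> n" "degree r < m"
  shows "poly_integral ((pderiv ^^ m) V * r) = 0"
  using assms(2,3)
proof (induction m arbitrary: r)
  case (Suc m)
  let ?P = "(pderiv ^^ m) V"
  have "poly_integral (pderiv ?P * r) + poly_integral (?P * pderiv r) = poly_integral (pderiv (?P * r))"
    by (simp add: pderiv_mult poly_integral_add algebra_simps)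
  also have "\<dots> = 0"
    using higher_pderiv_endpoints[OF assms(1), of m] Suc.prems by (simp add: poly_integral_pderiv)
  finally have parts: "poly_integral (pderiv ?P * r) = - poly_integral (?P * pderiv r)" by simp
  show ?case
  proof (cases "degree r = 0")
    case True
    then show ?thesis using parts pderiv_eq_0_iff[of r] by simp
  next
    case False
    then have "degree (pderiv r) < m" using Suc.prems(2) by (simp add: degree_pderiv)
    then show ?thesis using parts Suc by simp
  qed
qed simp

text \<open>
  What convergence requires of a single grid, apart from exactness, which is automatic.
\<close>

definition admissible :: "(nat \<Rightarrow> real) \<Rightarrow> nat \<Rightarrow> bool" where
  "admissible t N \<longleftrightarrow> inj_on t {..N} \<and> t ` {..N} \<subseteq> {-1..1} \<and> (\<forall>j\<le>N. 0 \<le> birkhoff_weight t N j)"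

text \<open>
  The list behind \<open>zeros\<close> enumerates exactly the \<open>N + 1\<close> roots in \<open>T\<close>, since a polynomial of degree \<open>N + 1\<close>
  has no others; in particular every index up to \<open>N\<close> is within the bounds of the list.
\<close>

lemma zeros_enumerates:
  assumes "z \<noteq> 0" "degree z = N + 1" "card T = N + 1" "\<And>x. x \<in> T \<Longrightarrow> poly z x = 0"
  shows "inj_on (zeros z) {..N}" "\<And>j. j \<le> N \<Longrightarrow> zeros z j \<in> T"
proof -
  let ?R = "{x. poly z x = 0}"
  have fin: "finite ?R" using assms(1) by (rule poly_roots_finite)
  have "T = ?R"
    using card_poly_roots_bound[OF assms(1)] assms by (intro card_seteq[OF fin]) auto
  then have len: "length (sorted_list_of_set ?R) = N + 1" and set: "set (sorted_list_of_set ?R) = T"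
    using assms(3) fin by auto
  show "inj_on (zeros z) {..N}"
    using len by (auto simp: inj_on_def zeros_def nth_eq_iff_index_eq)
  show "zeros z j \<in> T" if "j \<le> N" for j
    using that len set nth_mem[of j "sorted_list_of_set ?R"] by (simp add: zeros_def)
qed

lemma admissible_zeros:
  fixes z s :: "real poly"
  assumes "N \<ge> 1" "degree z = N + 1"
    and T: "card T = N + 1" "T \<subseteq> {-1..1}" "\<And>x. x \<in> T \<Longrightarrow> poly z x = 0"
    and "\<And>r. degree r < N - 1 \<Longrightarrow> poly_integral (z * r) = 0"
    and "degree s = N - 1" "lead_coeff z * lead_coeff s > 0" "poly_integral (z * s) \<le> 0"
  shows "admissible (zeros z) N"
proof -
  have "z \<noteq> 0" using assms(2) by auto
  note zeros = zeros_enumerates[OF this assms(2) T(1,3)]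
  have "0 \<le> birkhoff_weight (zeros z) N j" if "j \<le> N" for j
    using zeros T(3) assms that
    by (intro birkhoff_weight_nonneg_if_orthogonal[of "zeros z" N j z s]) auto
  then show ?thesis
    using zeros T(2) by (auto simp: admissible_def)
qed

text \<open>
  With one more degree of orthogonality, \<open>z\<close> is orthogonal to every polynomial of degree \<open>N - 1\<close>, so
  any such polynomial with the right sign of the leading coefficient serves for comparison.
\<close>

lemma admissible_zeros_gauss_type:
  fixes z :: "real poly"
  assumes "N \<ge> 1" "degree z = N + 1"
    and "card T = N + 1" "T \<subseteq> {-1..1}" "\<And>x. x \<in> T \<Longrightarrow> poly z x = 0"
    and orth: "\<And>r. degree r < N \<Longrightarrow> poly_integral (z * r) = 0"
  shows "admissible (zeros z) N"
proof (rule admissible_zeros)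
  \<comment> \<open>the factor makes the product of the leading coefficients a square\<close>
  let ?s = "smult (lead_coeff z) (monom 1 (N - 1))"
  have "z \<noteq> 0" using assms(2) by auto
  then have z: "lead_coeff z \<noteq> 0" by simp
  then show deg: "degree ?s = N - 1" by (simp add: degree_monom_eq)
  show "lead_coeff z * lead_coeff ?s > 0"
  proof -
    have "0 < lead_coeff z * lead_coeff z" using z by (metis not_real_square_gt_zero)
    then show ?thesis using \<open>z \<noteq> 0\<close> by (simp add: degree_monom_eq)
  qed
  show "poly_integral (z * ?s) \<le> 0" using orth[of ?s] deg assms(1) by simp
qed (use assms in auto)

lemma degree_square_minus_one_power: "degree ([:-1, 0, 1::real:] ^ n) = 2 * n"
  by (subst degree_power_eq) auto

lemma degree_legendre: "degree (legendre n) = n"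
  by (simp add: legendre_def degree_higher_pderiv degree_square_minus_one_power)

lemma legendre_orthogonal: "degree r < n \<Longrightarrow> poly_integral (legendre n * r) = 0"
  using higher_pderiv_orthogonal[of n "[:-1, 0, 1:] ^ n" n r]
  by (simp add: legendre_def poly_integral_smult)

lemma legendre_interior_roots:
  "\<exists>T. finite T \<and> card T = n \<and> T \<subseteq> {-1<..<1} \<and> (\<forall>x\<in>T. poly (legendre n) x = 0)"
  using higher_pderiv_interior_roots[of n "[:-1, 0, 1:] ^ n" n] by (auto simp: legendre_def)

lemma admissible_LG:
  assumes "N \<ge> 1"
  shows "admissible (node LG N) N"
proof -
  obtain T where "card T = N + 1" "T \<subseteq> {-1<..<1}" "\<forall>x\<in>T. poly (legendre (N + 1)) x = 0"
    using legendre_interior_roots by blast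
  then have "admissible (zeros (legendre (N + 1))) N"
    using assms by (intro admissible_zeros_gauss_type[where T = T])
      (auto simp: degree_legendre legendre_orthogonal subset_iff less_imp_le)
  moreover have "node LG N = zeros (legendre (N + 1))" by auto
  ultimately show ?thesis by simp
qed

text \<open>
  One of the \<open>N + 1\<close> derivatives in the formula for \<open>P\<^sub>N\<^sub>+\<^sub>1\<close> is carried out, turning \<open>(x\<^sup>2 - 1)\<^sup>N\<^sup>+\<^sup>1\<close>
  into a multiple of \<open>x (x\<^sup>2 - 1)\<^sup>N\<close>; both summands are then \<open>N\<close>-th derivatives with the same factor.
\<close>

lemma legendre_sum_rodrigues:
  "legendre N + legendre (N + 1) =
    smult (1 / (2 ^ N * fact N)) ((pderiv ^^ N) ([:1, 1:] * [:-1, 0, 1:] ^ N))"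
proof -
  have "pderiv ([:-1, 0, 1:] ^ Suc N) = smult (2 * real (Suc N)) ([:0, 1:] * [:-1, 0, 1:] ^ N)"
    unfolding pderiv_power_Suc by (simp add: pderiv_pCons algebra_simps smult_add_left flip: smult_smult)
  moreover have "1 / (2 ^ Suc N * fact (Suc N)) * (2 * real (Suc N)) = 1 / (2 ^ N * fact N)"
    by (simp add: divide_simps)
  ultimately have "legendre (N + 1) = smult (1 / (2 ^ N * fact N)) ((pderiv ^^ N) ([:0, 1:] * [:-1, 0, 1:] ^ N))"
    unfolding legendre_def Suc_eq_plus1[symmetric] funpow_Suc_right o_apply
    by (simp only: higher_pderiv_smult smult_smult)
  moreover have "[:1, 1:] * [:-1, 0, 1:] ^ N = [:-1, 0, 1:] ^ N + [:0, 1:] * [:-1, 0, 1::real:] ^ N"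
    by simp
  ultimately show ?thesis
    by (simp only: legendre_def higher_pderiv_add smult_add_right)
qed

text \<open>
  By the Rodrigues formula for the sum, the node polynomial is an \<open>N\<close>-th derivative of a multiple of
  \<open>(x\<^sup>2 - 1)\<^sup>N\<close>, which yields \<open>N\<close> interior roots and orthogonality. The remaining node \<open>-1\<close> comes from the extra factor \<open>x + 1\<close>,
  which makes \<open>-1\<close> a root of multiplicity \<open>N + 1\<close> before differentiation.
\<close>

lemma admissible_LGR:
  assumes "N \<ge> 1"
  shows "admissible (node LGR N) N"
proof -
  define V :: "real poly" where "V = [:1, 1:] * [:-1, 0, 1:] ^ N"
  define z where "z = legendre N + legendre (N + 1)"
  have z: "z = smult (1 / (2 ^ N * fact N)) ((pderiv ^^ N) V)"
    unfolding z_def V_def by (rule legendre_sum_rodrigues)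
  have dvd: "[:-1, 0, 1:] ^ N dvd V" unfolding V_def by (rule dvd_triv_right)
  have "degree V = 2 * N + 1"
    unfolding V_def by (subst degree_mult_eq) (auto simp: degree_square_minus_one_power)
  then have degree: "degree z = N + 1"
    by (simp add: z degree_higher_pderiv)
  obtain T where T: "finite T" "card T = N" "T \<subseteq> {-1<..<1}" "\<forall>x\<in>T. poly z x = 0"
    using higher_pderiv_interior_roots[OF dvd order_refl] by (auto simp: z)
  have "[:-1, 0, 1:] = [:1, 1:] * [:-1, 1::real:]" by simp
  then have "V = [:1, 1:] ^ (N + 1) * [:-1, 1:] ^ N"
    by (simp only: V_def power_mult_distrib Suc_eq_plus1[symmetric] power_Suc mult.assoc)
  then have "[:1, 1:] dvd (pderiv ^^ N) V"
    using power_dvd_higher_pderiv[of "[:1, 1:]" "N + 1" V N] by simp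
  then have "poly z (-1) = 0"
    by (auto simp: z elim!: dvdE)
  moreover have "-1 \<notin> T" using T(3) by auto
  ultimately have "admissible (zeros z) N"
    using assms degree T higher_pderiv_orthogonal[OF dvd order_refl]
    by (intro admissible_zeros_gauss_type[where T = "insert (-1) T"])
       (auto simp: z poly_integral_smult subset_iff less_imp_le)
  moreover have "node LGR N = zeros z" by (auto simp: z_def)
  ultimately show ?thesis by simp
qed

text \<open>
  Since the factor \<open>1 - x\<^sup>2\<close> vanishes at the endpoints, integration by parts moves the derivative away
  from \<open>P\<^sub>N\<close>, and orthogonality of \<open>P\<^sub>N\<close> gives orthogonality of the node polynomial to degrees below
  \<open>N - 1\<close>. In degree \<open>N - 1\<close> the comparison polynomial is \<open>- P\<^sub>N'\<close>, whose product with the node polynomial is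
  \<open>- (1 - x\<^sup>2) P\<^sub>N'\<^sup>2\<close>.
\<close>

lemma admissible_LGL:
  assumes "N \<ge> 1"
  shows "admissible (node LGL N) N"
proof -
  define P where "P = pderiv (legendre N)"
  define w :: "real poly" where "w = [:1, 0, -1:]"
  have degP: "degree P = N - 1" by (simp add: P_def degree_pderiv degree_legendre)
  have "P \<noteq> 0" using assms pderiv_eq_0_iff[of "legendre N"] by (simp add: P_def degree_legendre)
  then have degree: "degree (w * P) = N + 1"
    using assms degP by (simp add: w_def degree_mult_eq del: mult_pCons_left)
  obtain T0 where "finite T0" "card T0 = N" "T0 \<subseteq> {-1<..<1}" "\<forall>x\<in>T0. poly (legendre N) x = 0"
    using legendre_interior_roots by blast
  then obtain T where T: "finite T" "card T = N - 1" "T \<subseteq> {-1<..<1}" "\<forall>x\<in>T. poly P x = 0"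
    using rolle_roots[of T0 "N - 1" "-1" 1 "legendre N"] assms by (auto simp: P_def subset_iff less_imp_le)
  have "-1 \<notin> T" "1 \<notin> T" using T(3) by auto
  then have T': "card (insert (-1) (insert 1 T)) = N + 1" using T assms by simp
  have orth: "poly_integral (w * P * r) = 0" if r: "degree r < N - 1" for r
  proof -
    have "poly_integral (w * P * r) + poly_integral (legendre N * pderiv (w * r)) = poly_integral (pderiv (legendre N * (w * r)))"
      unfolding pderiv_mult[of "legendre N" "w * r"] poly_integral_add by (simp add: P_def mult_ac)
    also have "\<dots> = 0" by (simp add: poly_integral_pderiv w_def)
    finally have "poly_integral (w * P * r) = - poly_integral (legendre N * pderiv (w * r))" by simp
    also have "degree (w * r) \<le> degree w + degree r" by (rule degree_mult_le)
    then have "degree (pderiv (w * r)) < N" using r by (simp add: degree_pderiv w_def)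
    then have "poly_integral (legendre N * pderiv (w * r)) = 0" by (rule legendre_orthogonal)
    finally show ?thesis by simp
  qed
  have "admissible (zeros (w * P)) N"
  proof (rule admissible_zeros[where s = "- P", OF assms degree T'])
    show "insert (-1) (insert 1 T) \<subseteq> {-1..1}" using T(3) by auto
    show "poly (w * P) x = 0" if "x \<in> insert (-1) (insert 1 T)" for x
      using that T(4) by (auto simp: w_def)
    show "degree (- P) = N - 1" using degP by simp
    have "lead_coeff (w * P) = - lead_coeff P" by (simp only: lead_coeff_mult) (simp add: w_def)
    moreover have "0 < lead_coeff P * lead_coeff P"
      using \<open>P \<noteq> 0\<close> by (metis leading_coeff_0_iff not_real_square_gt_zero)
    ultimately show "lead_coeff (w * P) * lead_coeff (- P) > 0"
      by (simp add: lead_coeff_minus)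
    have "0 \<le> poly_integral (w * P^2)"
    proof (rule poly_integral_nonneg)
      fix x :: real assume "x \<in> {-1..1}"
      then have "x^2 \<le> 1" by (simp add: abs_square_le_1 abs_le_iff)
      then have "0 \<le> (1 - x^2) * (poly P x)^2" by simp
      then show "0 \<le> poly (w * P^2) x" by (simp add: w_def power2_eq_square algebra_simps)
    qed
    also have "w * P^2 = - (w * P * - P)" by (simp add: power2_eq_square algebra_simps)
    finally show "poly_integral (w * P * - P) \<le> 0" by (simp only: poly_integral_minus)
  qed (fact orth)
  moreover have "node LGL N = zeros (w * P)" by (auto simp: w_def P_def)
  ultimately show ?thesis by simp
qed

section \<open>Chebyshev grids\<close>

text \<open>
  The polynomial \<open>T\<^sub>k(- x)\<close> with \<open>T\<^sub>k\<close> the Chebyshev polynomial of the first kind. The reflection matches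
  the sign in \<open>\<tau> = - cos \<theta>\<close>, so that no factor \<open>(-1)\<^sup>k\<close> appears.
\<close>

fun reflected_cheb :: "nat \<Rightarrow> real poly" where
  "reflected_cheb 0 = 1"
| "reflected_cheb (Suc 0) = [:0, -1:]"
| "reflected_cheb (Suc (Suc k)) = [:0, -2:] * reflected_cheb (Suc k) - reflected_cheb k"

lemma degree_reflected_cheb: "degree (reflected_cheb k) \<le> k"
proof (induction k rule: reflected_cheb.induct)
  case (3 k)
  have "degree ([:0, -2:] * reflected_cheb (Suc k)) \<le> 1 + degree (reflected_cheb (Suc k))"
    by (rule order.trans[OF degree_mult_le]) simp
  then show ?case
    using 3 by (simp only: reflected_cheb.simps) (intro degree_diff_le; linarith)
qed simp_all

lemma poly_reflected_cheb: "poly (reflected_cheb k) (- cos \<theta>) = cos (real k * \<theta>)"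
proof (induction k rule: reflected_cheb.induct)
  case (3 k)
  have "cos (real (Suc k) * \<theta> + \<theta>) + cos (real (Suc k) * \<theta> - \<theta>) = 2 * cos \<theta> * cos (real (Suc k) * \<theta>)"
    by (simp add: cos_add cos_diff)
  then have "cos (real (Suc (Suc k)) * \<theta>) = 2 * cos \<theta> * cos (real (Suc k) * \<theta>) - cos (real k * \<theta>)"
    by (simp add: algebra_simps)
  then show ?case
    using 3 by (simp only: reflected_cheb.simps) simp
qed simp_all

text \<open>
  The substitution \<open>x = - cos \<theta>\<close> turns the integrand into \<open>cos (k \<theta>) sin \<theta>\<close>, a difference of two sines
  with an elementary antiderivative. The proof compares this antiderivative with an antiderivative
  \<open>P\<close> of the polynomial: their difference \<open>g\<close> has derivative \<open>0\<close>.
\<close>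

lemma poly_integral_reflected_cheb:
  assumes "k \<noteq> 1"
  shows "poly_integral (reflected_cheb k) = - ((1 + cos (real k * pi)) / ((real k)^2 - 1))"
proof -
  obtain P where P: "pderiv P = reflected_cheb k"
    using ex_antiderivative by blast
  define g where "g \<theta> = poly P (- cos \<theta>) - cos ((real k - 1) * \<theta>) / (2 * (real k - 1))
      + cos ((real k + 1) * \<theta>) / (2 * (real k + 1))" for \<theta>
  have k: "real k - 1 \<noteq> 0" "real k + 1 \<noteq> 0" using assms by auto
  have "DERIV g \<theta> :> 0" for \<theta>
  proof -
    have P': "((\<lambda>\<theta>. poly P (- cos \<theta>)) has_real_derivative cos (real k * \<theta>) * sin \<theta>) (at \<theta>)"
      by (rule DERIV_chain2[OF poly_DERIV, THEN DERIV_cong])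
         (auto intro!: derivative_eq_intros simp: P poly_reflected_cheb)
    have "((\<lambda>\<theta>. cos (a * \<theta>) / (2 * a)) has_real_derivative - sin (a * \<theta>) / 2) (at \<theta>)" if "a \<noteq> 0" for a :: real
      using that by (auto intro!: derivative_eq_intros)
    from DERIV_add[OF DERIV_diff[OF P' this[OF k(1)]] this[OF k(2)]]
    have "DERIV g \<theta> :> cos (real k * \<theta>) * sin \<theta> - - sin ((real k - 1) * \<theta>) / 2 + - sin ((real k + 1) * \<theta>) / 2"
      by (simp only: g_def[abs_def])
    moreover have "sin ((real k + 1) * \<theta>) - sin ((real k - 1) * \<theta>) = 2 * cos (real k * \<theta>) * sin \<theta>"
      by (simp add: distrib_right left_diff_distrib sin_add sin_diff)
    ultimately show ?thesis by (simp add: field_simps)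
  qed
  then have "g pi = g 0"
    by (intro DERIV_isconst_all) auto
  moreover have "cos ((real k - 1) * pi) = - cos (real k * pi)" "cos ((real k + 1) * pi) = - cos (real k * pi)"
    by (simp_all add: distrib_right left_diff_distrib cos_add cos_diff)
  ultimately have "poly P 1 - poly P (-1) =
      (1 + cos (real k * pi)) * (1 / (2 * (real k + 1)) - 1 / (2 * (real k - 1)))"
    by (simp add: g_def algebra_simps add_divide_distrib)
  also have "1 / (2 * (real k + 1)) - 1 / (2 * (real k - 1)) = - 1 / ((real k)^2 - 1)"
  proof -
    have "(real k)^2 - 1 = (real k - 1) * (real k + 1)"
      by (simp add: power2_eq_square algebra_simps)
    then show ?thesis using k by (simp only:) (simp add: divide_simps, simp add: algebra_simps)
  qed
  finally show ?thesis
    using poly_integral_pderiv[of P] by (simp add: P)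
qed

lemma poly_integral_reflected_cheb_odd: "odd k \<Longrightarrow> poly_integral (reflected_cheb k) = 0"
proof (cases "k = 1")
  case True
  have "pderiv [:0, 0, -1/2:] = [:0, -1::real:]"
    by (simp add: pderiv_pCons)
  then have "poly_integral [:0, -1:] = poly [:0, 0, -1/2:] 1 - poly [:0, 0, -1/2:] (-1)"
    using poly_integral_pderiv[of "[:0, 0, -1/2:]"] by (simp only:)
  with True show ?thesis by simp
qed (simp add: poly_integral_reflected_cheb)

text \<open>
  Only even indices contribute, and for these
  \<open>2 / (4 n\<^sup>2 - 1) = 1 / (2 n - 1) - 1 / (2 n + 1)\<close> telescopes.
\<close>

lemma sum_abs_poly_integral_reflected_cheb_odd:
  "(\<Sum>k=1..2 * M + 1. \<bar>poly_integral (reflected_cheb k)\<bar>) = 1 - 1 / (2 * real M + 1)"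
proof (induction M)
  case 0
  show ?case using poly_integral_reflected_cheb_odd[of 1] by simp
next
  case (Suc M)
  have "\<bar>poly_integral (reflected_cheb (2 * M + 2))\<bar> = 2 / ((2 * real M + 1) * (2 * real M + 3))"
  proof -
    have "(real (2 * M + 2))^2 - 1 = (2 * real M + 1) * (2 * real M + 3)"
      by (simp add: power2_eq_square algebra_simps)
    moreover have "cos (real (2 * M + 2) * pi) = 1"
      using cos_npi[of "2 * M + 2"] by simp
    ultimately show ?thesis
      by (subst poly_integral_reflected_cheb) (simp, simp only:, simp add: abs_mult)
  qed
  moreover have "poly_integral (reflected_cheb (2 * M + 3)) = 0"
    by (rule poly_integral_reflected_cheb_odd) simp
  moreover have "(\<Sum>k=1..2 * Suc M + 1. \<bar>poly_integral (reflected_cheb k)\<bar>) =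
      (\<Sum>k=1..2 * M + 1. \<bar>poly_integral (reflected_cheb k)\<bar>) + \<bar>poly_integral (reflected_cheb (2 * M + 2))\<bar>
        + \<bar>poly_integral (reflected_cheb (2 * M + 3))\<bar>"
    by (simp add: numeral_3_eq_3 del: reflected_cheb.simps)
  moreover have "1 - 1 / (2 * real M + 1) + 2 / ((2 * real M + 1) * (2 * real M + 3)) =
      1 - 1 / (2 * real (Suc M) + 1)"
    by (simp add: divide_simps) (simp add: algebra_simps)
  ultimately show ?case
    using Suc.IH by (simp only:)
qed

lemma sum_abs_poly_integral_reflected_cheb_le: "(\<Sum>k=1..N. \<bar>poly_integral (reflected_cheb k)\<bar>) \<le> 1"
proof -
  have "(\<Sum>k=1..N. \<bar>poly_integral (reflected_cheb k)\<bar>) \<le> (\<Sum>k=1..2 * N + 1. \<bar>poly_integral (reflected_cheb k)\<bar>)"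
    by (rule sum_mono2) auto
  also have "\<dots> \<le> 1" unfolding sum_abs_poly_integral_reflected_cheb_odd by simp
  finally show ?thesis .
qed

text \<open>
  The test polynomial for the node \<open>j\<close> is the cosine sum \<open>\<Sum>k\<le>N. c\<^sub>k cos (k \<theta>\<^sub>j) cos (k \<theta>)\<close> in the variable
  \<open>- cos \<theta>\<close>. At the node itself it is a sum of nonnegative terms with first term \<open>1\<close>, so that
  orthogonality also forces the nodes to be distinct. Its integral is at least \<open>2 - 2 (\<Sum>k=1..N. \<bar>\<integral>T\<^sub>k\<bar>)\<close>,
  hence nonnegative.
\<close>

lemma admissible_if_discrete_orthogonal:
  assumes t: "\<And>j. t j = - cos (\<theta> j)"
    and c: "c 0 = 1" "\<And>k. 0 \<le> c k" "\<And>k. c k \<le> 2"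
    and orth: "\<And>i j. i \<le> N \<Longrightarrow> j \<le> N \<Longrightarrow> i \<noteq> j \<Longrightarrow>
      (\<Sum>k\<le>N. c k * cos (real k * \<theta> i) * cos (real k * \<theta> j)) = 0"
  shows "admissible t N"
proof -
  define q where "q j = (\<Sum>k\<le>N. smult (c k * cos (real k * \<theta> j)) (reflected_cheb k))" for j
  have deg: "degree (q j) \<le> N" for j
    unfolding q_def
    by (intro degree_sum_le order.trans[OF degree_smult_le])
       (auto intro: order.trans[OF degree_reflected_cheb])
  have at_nodes: "poly (q j) (t i) = (\<Sum>k\<le>N. c k * cos (real k * \<theta> i) * cos (real k * \<theta> j))" for i j
    by (simp add: q_def poly_sum t poly_reflected_cheb mult_ac)
  have off: "poly (q j) (t i) = 0" if "i \<le> N" "j \<le> N" "i \<noteq> j" for i j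
    using orth[OF that] by (simp add: at_nodes)
  have diag: "poly (q j) (t j) > 0" for j
  proof -
    have "c 0 * cos (real 0 * \<theta> j) * cos (real 0 * \<theta> j) \<le> (\<Sum>k\<le>N. c k * cos (real k * \<theta> j) * cos (real k * \<theta> j))"
      by (rule member_le_sum) (auto simp: c mult.assoc)
    then show ?thesis by (simp add: at_nodes c(1))
  qed
  have inj: "inj_on t {..N}"
  proof (rule inj_onI, rule ccontr)
    fix i j assume "i \<in> {..N}" "j \<in> {..N}" "t i = t j" "i \<noteq> j"
    then show False using off[of i j] diag[of j] by simp
  qed
  have int: "poly_integral (q j) \<ge> 0" for j
  proof -
    have "- 2 * \<bar>poly_integral (reflected_cheb k)\<bar> \<le> c k * cos (real k * \<theta> j) * poly_integral (reflected_cheb k)" for k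
    proof -
      have "\<bar>c k * cos (real k * \<theta> j)\<bar> \<le> 2 * 1"
        unfolding abs_mult using c by (intro mult_mono) auto
      then have "\<bar>c k * cos (real k * \<theta> j) * poly_integral (reflected_cheb k)\<bar> \<le> 2 * \<bar>poly_integral (reflected_cheb k)\<bar>"
        unfolding abs_mult[of _ "poly_integral _"] by (intro mult_right_mono) auto
      then show ?thesis by linarith
    qed
    then have "- 2 * (\<Sum>k=1..N. \<bar>poly_integral (reflected_cheb k)\<bar>) \<le>
        (\<Sum>k=1..N. c k * cos (real k * \<theta> j) * poly_integral (reflected_cheb k))"
      unfolding sum_distrib_left by (intro sum_mono)
    then have "- 2 \<le> (\<Sum>k=1..N. c k * cos (real k * \<theta> j) * poly_integral (reflected_cheb k))"
      using sum_abs_poly_integral_reflected_cheb_le[of N] by linarith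
    moreover have "poly_integral (reflected_cheb 0) = 2"
      by (subst poly_integral_reflected_cheb) simp_all
    moreover have "poly_integral (q j) = (\<Sum>k=0..N. c k * cos (real k * \<theta> j) * poly_integral (reflected_cheb k))"
      by (simp add: q_def poly_integral_sum poly_integral_smult atMost_atLeast0)
    ultimately show ?thesis
      using c(1) by (simp add: sum.atLeast_Suc_atMost)
  qed
  have "0 \<le> birkhoff_weight t N j" if "j \<le> N" for j
    using off[OF _ that] diag[of j] int[of j]
    by (intro birkhoff_weight_nonneg_if_test_poly[OF inj that deg[of j]]) auto
  moreover have "t ` {..N} \<subseteq> {-1..1}"
    by (auto simp: t)
  ultimately show ?thesis
    using inj by (simp add: admissible_def)
qed

lemma dirichlet_kernel:
  "sin (\<phi> / 2) * (\<Sum>k\<le>N. (if k = 0 then 1 else 2) * cos (real k * \<phi>)) = sin ((real N + 1 / 2) * \<phi>)"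
proof (induction N)
  case (Suc N)
  have "sin ((real N + 1) * \<phi> + \<phi> / 2) - sin ((real N + 1) * \<phi> - \<phi> / 2) =
      sin (\<phi> / 2) * (2 * cos ((real N + 1) * \<phi>))"
    by (simp add: sin_add sin_diff)
  then have "sin ((real N + 1 + 1 / 2) * \<phi>) = sin ((real N + 1 / 2) * \<phi>) + sin (\<phi> / 2) * (2 * cos ((real N + 1) * \<phi>))"
    by (simp add: algebra_simps)
  then show ?case
    using Suc.IH by (simp add: distrib_left algebra_simps)
qed simp

text \<open>
  Discrete orthogonality at two nodes is thereby reduced to the values of one kernel at the difference
  and at the sum of the two angles.
\<close>

lemma sum_cos_times_cos:
  fixes c :: "nat \<Rightarrow> real"
  shows "(\<Sum>k\<le>N. c k * cos (real k * \<alpha>) * cos (real k * \<beta>)) =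
    ((\<Sum>k\<le>N. c k * cos (real k * (\<alpha> - \<beta>))) + (\<Sum>k\<le>N. c k * cos (real k * (\<alpha> + \<beta>)))) / 2"
  unfolding sum.distrib[symmetric] sum_divide_distrib
  by (rule sum.cong) (simp_all add: right_diff_distrib distrib_left cos_diff cos_add)

lemma sin_fraction_pi_neq_0:
  assumes "m \<noteq> 0" "\<bar>m\<bar> < int K"
  shows "sin (of_int m * pi / real K) \<noteq> 0"
proof
  assume "sin (of_int m * pi / real K) = 0"
  then obtain i :: int where "of_int m * pi / real K = of_int i * pi"
    unfolding sin_zero_iff_int2 by blast
  then have "(of_int m :: real) = of_int (i * int K)"
    using assms by (simp add: field_simps)
  then have "m = i * int K" by (simp only: of_int_eq_iff)
  moreover from this have "\<bar>i\<bar> \<ge> 1" using assms(1) by auto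
  ultimately have "\<bar>m\<bar> \<ge> int K"
    using mult_right_mono[of 1 "\<bar>i\<bar>" "int K"] by (simp add: abs_mult)
  then show False using assms(2) by simp
qed

lemma mult_eq_0_cancel: "a * b = 0 \<Longrightarrow> a \<noteq> 0 \<Longrightarrow> b = 0" for a b :: real
  by simp

text \<open>
  At the differences and sums of two distinct angles the Dirichlet kernel vanishes.
\<close>

lemma admissible_CGR:
  assumes "N \<ge> 1"
  shows "admissible (node CGR N) N"
proof (rule admissible_if_discrete_orthogonal)
  let ?c = "\<lambda>k. (if k = 0 then 1 else 2) :: real"
  let ?\<theta> = "\<lambda>j. (2 * real j) / (2 * real N + 1) * pi"
  show "node CGR N j = - cos (?\<theta> j)" for j by simp
  have kernel: "(\<Sum>k\<le>N. ?c k * cos (real k * \<phi>)) = 0"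
    if "m \<noteq> 0" "\<bar>m\<bar> < int (2 * N + 1)" "\<phi> = 2 * (of_int m * pi / real (2 * N + 1))" for m \<phi>
  proof -
    have "\<phi> / 2 = of_int m * pi / real (2 * N + 1)"
      unfolding that(3) by (rule nonzero_mult_div_cancel_left) simp
    then have "sin (\<phi> / 2) \<noteq> 0" using sin_fraction_pi_neq_0[OF that(1,2)] by (simp only: not_False_eq_True)
    moreover have "(real N + 1 / 2) * \<phi> = of_int m * pi"
      unfolding that(3) by (simp add: field_simps)
    moreover have "sin (of_int m * pi) = 0" by (auto simp: sin_zero_iff_int2)
    ultimately have "sin (\<phi> / 2) * (\<Sum>k\<le>N. ?c k * cos (real k * \<phi>)) = 0"
      unfolding dirichlet_kernel by (simp only:)
    then show ?thesis by (rule mult_eq_0_cancel) fact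
  qed
  fix i j assume ij: "i \<le> N" "j \<le> N" "i \<noteq> j"
  have "?\<theta> i - ?\<theta> j = 2 * (of_int (int i - int j) * pi / real (2 * N + 1))"
    by (simp add: divide_simps) (simp add: algebra_simps)
  note minus = kernel[OF _ _ this]
  have "?\<theta> i + ?\<theta> j = 2 * (of_int (int i + int j) * pi / real (2 * N + 1))"
    by (simp add: divide_simps) (simp add: algebra_simps)
  note plus = kernel[OF _ _ this]
  have "(\<Sum>k\<le>N. ?c k * cos (real k * (?\<theta> i - ?\<theta> j))) = 0"
    by (rule minus) (use ij assms in auto)
  moreover have "(\<Sum>k\<le>N. ?c k * cos (real k * (?\<theta> i + ?\<theta> j))) = 0"
    by (rule plus) (use ij assms in auto)
  ultimately show "(\<Sum>k\<le>N. ?c k * cos (real k * ?\<theta> i) * cos (real k * ?\<theta> j)) = 0"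
    unfolding sum_cos_times_cos by (simp only: add_0_left div_0)
qed auto

text \<open>
  The Dirichlet kernel does not vanish at the differences and sums of the angles: at
  \<open>m \<pi> / (N + 1)\<close> its value is \<open>- (-1)\<^sup>m\<close>. The indices \<open>i - j\<close> and \<open>i + j + 1\<close> that occur have opposite
  parity, so the two values cancel.
\<close>

lemma admissible_CG:
  assumes "N \<ge> 1"
  shows "admissible (node CG N) N"
proof (rule admissible_if_discrete_orthogonal)
  let ?c = "\<lambda>k. (if k = 0 then 1 else 2) :: real"
  let ?\<theta> = "\<lambda>j. (2 * real j + 1) / (2 * real N + 2) * pi"
  show "node CG N j = - cos (?\<theta> j)" for j by simp
  have kernel: "(\<Sum>k\<le>N. ?c k * cos (real k * \<phi>)) = - cos (of_int m * pi)"
    if "m \<noteq> 0" "\<bar>m\<bar> < int (2 * N + 2)" "\<phi> = 2 * (of_int m * pi / real (2 * N + 2))" for m \<phi>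
  proof -
    have "\<phi> / 2 = of_int m * pi / real (2 * N + 2)"
      unfolding that(3) by (rule nonzero_mult_div_cancel_left) simp
    then have "sin (\<phi> / 2) \<noteq> 0" using sin_fraction_pi_neq_0[OF that(1,2)] by (simp only: not_False_eq_True)
    moreover have "(real N + 1 / 2) * \<phi> = of_int m * pi - \<phi> / 2"
      unfolding that(3) by (simp add: field_simps)
    moreover have "sin (of_int m * pi) = 0" by (auto simp: sin_zero_iff_int2)
    ultimately have "sin (\<phi> / 2) * (\<Sum>k\<le>N. ?c k * cos (real k * \<phi>)) = sin (\<phi> / 2) * - cos (of_int m * pi)"
      using dirichlet_kernel[of \<phi> N] by (simp add: sin_diff)
    then show ?thesis using \<open>sin (\<phi> / 2) \<noteq> 0\<close> by (simp only: mult_cancel_left) simp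
  qed
  fix i j assume ij: "i \<le> N" "j \<le> N" "i \<noteq> j"
  have "?\<theta> i - ?\<theta> j = 2 * (of_int (int i - int j) * pi / real (2 * N + 2))"
    by (simp add: divide_simps) (simp add: algebra_simps)
  note minus = kernel[OF _ _ this]
  have "?\<theta> i + ?\<theta> j = 2 * (of_int (int i + int j + 1) * pi / real (2 * N + 2))"
    by (simp add: divide_simps) (simp add: algebra_simps)
  note plus = kernel[OF _ _ this]
  have "(- cos (of_int (int i - int j) * pi) + - cos (of_int (int i + int j + 1) * pi)) / 2 = 0"
    by (simp add: distrib_right left_diff_distrib cos_add cos_diff sin_add)
  moreover have "(\<Sum>k\<le>N. ?c k * cos (real k * (?\<theta> i - ?\<theta> j))) = - cos (of_int (int i - int j) * pi)"
    by (rule minus) (use ij in auto)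
  moreover have "(\<Sum>k\<le>N. ?c k * cos (real k * (?\<theta> i + ?\<theta> j))) = - cos (of_int (int i + int j + 1) * pi)"
    by (rule plus) (use ij in auto)
  ultimately show "(\<Sum>k\<le>N. ?c k * cos (real k * ?\<theta> i) * cos (real k * ?\<theta> j)) = 0"
    unfolding sum_cos_times_cos by (simp only:)
qed auto

text \<open>
  Halving the last term of the Dirichlet kernel gives a multiple of
  \<open>sin (N \<phi>) cos (\<phi> / 2) / sin (\<phi> / 2)\<close>, which vanishes at the multiples of \<open>\<pi> / N\<close> that occur.
\<close>

lemma admissible_CGL:
  assumes "N \<ge> 1"
  shows "admissible (node CGL N) N"
proof (rule admissible_if_discrete_orthogonal)
  let ?c = "\<lambda>k. (if k = 0 \<or> k = N then 1 else 2) :: real"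
  let ?\<theta> = "\<lambda>j. real j / real N * pi"
  show "node CGL N j = - cos (?\<theta> j)" for j by simp
  have kernel: "(\<Sum>k\<le>N. ?c k * cos (real k * \<phi>)) = 0"
    if "m \<noteq> 0" "\<bar>m\<bar> < int (2 * N)" "\<phi> = 2 * (of_int m * pi / real (2 * N))" for m \<phi>
  proof -
    have "(\<Sum>k\<le>N. ?c k * cos (real k * \<phi>)) =
        (\<Sum>k\<le>N. (if k = 0 then 1 else 2) * cos (real k * \<phi>) - (if N = k then cos (real N * \<phi>) else 0))"
      using assms by (intro sum.cong) auto
    also have "\<dots> = (\<Sum>k\<le>N. (if k = 0 then 1 else 2) * cos (real k * \<phi>)) - cos (real N * \<phi>)"
      by (simp add: sum_subtractf)
    finally have "sin (\<phi> / 2) * (\<Sum>k\<le>N. ?c k * cos (real k * \<phi>)) =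
        sin ((real N + 1 / 2) * \<phi>) - sin (\<phi> / 2) * cos (real N * \<phi>)"
      using dirichlet_kernel[of \<phi> N] by (simp add: right_diff_distrib)
    also have "(real N + 1 / 2) * \<phi> = real N * \<phi> + \<phi> / 2"
      by (simp add: algebra_simps)
    also have "sin (real N * \<phi> + \<phi> / 2) - sin (\<phi> / 2) * cos (real N * \<phi>) = sin (real N * \<phi>) * cos (\<phi> / 2)"
      by (simp add: sin_add)
    also have "real N * \<phi> = of_int m * pi"
      unfolding that(3) using assms by (simp add: field_simps)
    also have "sin (of_int m * pi) = 0" by (auto simp: sin_zero_iff_int2)
    finally have "sin (\<phi> / 2) * (\<Sum>k\<le>N. ?c k * cos (real k * \<phi>)) = 0" by simp
    moreover have "\<phi> / 2 = of_int m * pi / real (2 * N)"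
      unfolding that(3) by (rule nonzero_mult_div_cancel_left) simp
    then have "sin (\<phi> / 2) \<noteq> 0" using sin_fraction_pi_neq_0[OF that(1,2)] by (simp only: not_False_eq_True)
    ultimately show ?thesis by (rule mult_eq_0_cancel)
  qed
  fix i j assume ij: "i \<le> N" "j \<le> N" "i \<noteq> j"
  have "?\<theta> i - ?\<theta> j = 2 * (of_int (int i - int j) * pi / real (2 * N))"
    by (simp add: divide_simps) (simp add: algebra_simps)
  note minus = kernel[OF _ _ this]
  have "?\<theta> i + ?\<theta> j = 2 * (of_int (int i + int j) * pi / real (2 * N))"
    by (simp add: divide_simps) (simp add: algebra_simps)
  note plus = kernel[OF _ _ this]
  have "(\<Sum>k\<le>N. ?c k * cos (real k * (?\<theta> i - ?\<theta> j))) = 0"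
    by (rule minus) (use ij assms in auto)
  moreover have "(\<Sum>k\<le>N. ?c k * cos (real k * (?\<theta> i + ?\<theta> j))) = 0"
    by (rule plus) (use ij assms in auto)
  ultimately show "(\<Sum>k\<le>N. ?c k * cos (real k * ?\<theta> i) * cos (real k * ?\<theta> j)) = 0"
    unfolding sum_cos_times_cos by (simp only: add_0_left div_0)
qed auto

section \<open>Equivalence of the two interpolants\<close>

lemma admissible_node:
  assumes "N \<ge> 1"
  shows "admissible (node F N) N"
  by (cases F)
     (use assms in \<open>simp_all only: admissible_CGL admissible_CGR admissible_CG
        admissible_LGL admissible_LGR admissible_LG\<close>)

theorem proposition1:
  fixes F :: grid_family and y y' :: "real \<Rightarrow> real" and \<epsilon> :: real
  assumes "bounded (y ` {-1..1})"
    and "\<And>x. x \<in> {-1..1} \<Longrightarrow> (y has_real_derivative y' x) (at x within {-1..1})"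
    and "riemann_integrable y' (-1) 1"
    and "\<epsilon> > 0"
  shows "\<exists>N\<^sub>0\<ge>1. \<forall>N\<ge>N\<^sub>0. \<forall>\<tau>\<in>{-1..1}.
    \<bar>birkhoff_interp_b (node F N) N y y' \<tau> - birkhoff_interp_a (node F N) N y y' \<tau>\<bar> \<le> \<epsilon>"
proof -
  let ?Q = "\<lambda>N. \<Sum>j\<le>N. birkhoff_weight (node F N) N j * y' (node F N j)"
  interpret positive_quadrature "node F" "\<lambda>N. birkhoff_weight (node F N) N"
    using admissible_node[of _ F]
    by unfold_locales (auto simp: admissible_def image_subset_iff intro!: birkhoff_quadrature_exact)
  have "?Q \<longlonglongrightarrow> y 1 - y (-1)"
    using assms by (intro converges has_riemann_integral_derivative) auto
  then have "\<forall>\<^sub>F N in sequentially. dist (?Q N) (y 1 - y (-1)) < \<epsilon>"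
    using assms(4) by (rule tendstoD)
  then obtain M where M: "\<And>N. N \<ge> M \<Longrightarrow> dist (?Q N) (y 1 - y (-1)) < \<epsilon>"
    unfolding eventually_sequentially by blast
  have "\<bar>birkhoff_interp_b (node F N) N y y' \<tau> - birkhoff_interp_a (node F N) N y y' \<tau>\<bar> \<le> \<epsilon>"
    if "N \<ge> max 1 M" for N \<tau>
  proof -
    have "inj_on (node F N) {..N}"
      using admissible_node[of N F] that by (simp add: admissible_def)
    then show ?thesis
      using M[of N] that by (simp add: birkhoff_interp_diff dist_real_def abs_minus_commute)
  qed
  then show ?thesis
    by (intro exI[of _ "max 1 M"]) auto
qed

end
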